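(* For all integers $n\ge 2$ and $r\ge 1$, the Higman–Thompson group $G_{n,r}$ is a special co-ET0L group.
   Context: **Higman–Thompson groups.** Fix integers $r\ge 1$, $n\ge 2$, and disjoint sets $Q=\{q_1,\dots,q_r\}$, $\Sigma=\{\sigma_1,\dots,\sigma_n\}$ of cardinalities $r$ and $n$. Let $\Omega$ be the set of all infinite strings $q_i\sigma_{i_1}\sigma_{i_2}\sigma_{i_3}\cdots$ with $q_i\in Q$ and $\sigma_{i_j}\in\Sigma$ for $j\ge1$. A finite complete antichain in $\Omega$ is a finite subset $B$ of $Q\Sigma^*$ such that each $\omega\in\Omega$ has precisely one element of $B$ as a prefix. A bijection $\varphi:B\to C$ between two finite complete antichains induces a permutation of $\Omega$, also called $\varphi$, by $\omega^\varphi=b^\varphi\omega'$, where $\omega=b\omega'$ and $b$ is the unique prefix of $\omega$ in $B$. $G_{n,r}$ is the group of all such permutations of $\Omega$. (It is known to be finitely generated.) **Check stack pushdown automata (cspda).** A cspda $M$ over a finite input alphabet $A$ is a non-deterministic finite-state automaton (with a finite set of states, a single initial state, and a subset of accepting states) with a one-way input tape, a check stack with finite alphabet $\Delta$ and a pushdown stack with finite alphabet $\Gamma$. A computation has two stages. - First stage (initialisation): starting from the initial state, $M$ non-deterministically pushes symbols onto the check stack under the control of its finite-state control. It does not read input and does not use the pushdown stack. (So the possible check stack contents form a regular language.) - Second stage: the check stack is never altered. $M$ may read letters from the input tape and push symbols onto, or pop symbols from, the pushdown stack. The read-write head is always at the top of the pushdown stack and at the corresponding height on the check stack (it moves up by one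 on both when a symbol is pushed and down by one when a symbol is popped). Each transition depends on the current state, the top pushdown symbol, the check stack symbol at the same height, and, if it is a reading transition, the next input letter, which is consumed. It changes the state and may push or pop. $M$ accepts $w\in A^*$ if some computation enters an accepting state at some stage after reading all of $w$; $L(M)$ is the set of accepted words. A configuration consists of the state and the contents of the two stacks. **Special cspda.** $M$ is special if (P1)–(P7) hold. - (P1) Each state is either reading (all its out-transitions read an input letter) or non-reading (none of its out-transitions reads an input letter). - (P2) The operation of $M$ throughout the second stage is deterministic. - (P3) $\Delta$ and $\Gamma$ both contain a bottom-of-stack symbol $\mathfrak b$ and a padding symbol $\mathsf p$, and $\Delta$ contains a top-of-stack symbol $\mathfrak t$. After initialisation the check stack has $\mathfrak b$ at the bottom and $\mathfrak t$ at the top. The first transition of the second stage writes $\mathfrak b$ at the bottom of the pushdown stack, after which $M$ moves into a reading state. The symbol $\mathfrak b$ occurs only at the bottoms of the two stacks, $\mathfrak t$ occurs only at the top of the check stack, $\mathfrak b$ is never popped, and when $\mathfrak t$ is seen on the check stack no symbol can be pushed (so the head never moves above the top of the check stack). - (P4) No computation contains an infinitely long sequence of non-reading transitions in the second stage. - (P5) All accepting states are reading states. - (P6) For every entry configuration $C$ and all $u,v\in A^*$ with $v\notin L(M)$, either $C^{uv}=C^u$ or $C^{uv}$ fails. - (P7) The accepting states are exactly the reading states that are not entry states. Terminology used here: a configuration is reading (accepting) if its state is reading (accepting). An entry configuration is one arising immediately after the first transition of the second stage (the one writing $\mathfrak b$ on the pushdown stack), and its state is an entry state. A failing configuration is a non-accepting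 reading configuration from which no accepting configuration can be reached. For a reading configuration $C$ and $w\in A^*$, $C^w$ is the configuration of $M$, run in the second stage from $C$ on input $w$, as it enters its first reading state after reading all of $w$ (so $C^{\epsilon}=C$ for the empty word $\epsilon$). $C^w$ fails if a failing configuration is entered in this process, or if the machine gets stuck before reaching such a reading state. **Special co-ET0L groups.** A language accepted by a special cspda is a special ET0L language. For a group $G$ with finite inverse-closed generating set $A$, $\mathsf{coWP}(G,A)=\{w\in A^*: w\neq_G 1\}$. A finitely generated group $G$ is a special co-ET0L group if, for some finite inverse-closed generating set $A$ of $G$, some special cspda with input alphabet $A$ (and, by convention, $A\subseteq\Delta$, $A\subseteq\Gamma$) accepts $\mathsf{coWP}(G,A)$. *)

theory Defs
  imports "HOL-Library.Stream" "HOL-Algebra.Generated_Groups"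
begin

definition inf_strings :: "'x set \<Rightarrow> 'x set \<Rightarrow> 'x stream set" where
  "inf_strings Q \<Sigma> = {\<omega>. shd \<omega> \<in> Q \<and> sset (stl \<omega>) \<subseteq> \<Sigma>}"

definition fin_strings :: "'x set \<Rightarrow> 'x set \<Rightarrow> 'x list set" where
  "fin_strings Q \<Sigma> = {q # u | q u. q \<in> Q \<and> u \<in> lists \<Sigma>}"

definition is_prefix :: "'x list \<Rightarrow> 'x stream \<Rightarrow> bool" where
  "is_prefix b \<omega> \<longleftrightarrow> (\<exists>\<omega>'. \<omega> = b @- \<omega>')"

definition complete_antichain :: "'x set \<Rightarrow> 'x set \<Rightarrow> 'x list set \<Rightarrow> bool" where
  "complete_antichain Q \<Sigma> B \<longleftrightarrow>
     finite B \<and> B \<subseteq> fin_strings Q \<Sigma> \<and>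
     (\<forall>\<omega> \<in> inf_strings Q \<Sigma>. \<exists>!b. b \<in> B \<and> is_prefix b \<omega>)"

text \<open>Permutations of \<open>\<Omega>\<close> are represented by functions that are \<^const>\<open>undefined\<close> outside \<open>\<Omega>\<close>,
  so that equality of functions is equality of permutations.\<close>

definition prefix_exchange ::
  "'x set \<Rightarrow> 'x set \<Rightarrow> 'x list set \<Rightarrow> ('x list \<Rightarrow> 'x list) \<Rightarrow> 'x stream \<Rightarrow> 'x stream" where
  "prefix_exchange Q \<Sigma> B \<phi> =
     (\<lambda>\<omega> \<in> inf_strings Q \<Sigma>.
        let b = (THE b. b \<in> B \<and> is_prefix b \<omega>) in \<phi> b @- sdrop (length b) \<omega>)"

text \<open>Permutations act on the right: the product of \<open>f\<close> and \<open>g\<close> is \<open>f\<close> followed by \<open>g\<close>.\<close>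

definition higman_thompson :: "'x set \<Rightarrow> 'x set \<Rightarrow> ('x stream \<Rightarrow> 'x stream) monoid" where
  "higman_thompson Q \<Sigma> =
     \<lparr>carrier = {prefix_exchange Q \<Sigma> B \<phi> | B C \<phi>.
        complete_antichain Q \<Sigma> B \<and> complete_antichain Q \<Sigma> C \<and> bij_betw \<phi> B C},
      mult = (\<lambda>f g. compose (inf_strings Q \<Sigma>) g f),
      one = (\<lambda>\<omega> \<in> inf_strings Q \<Sigma>. \<omega>)\<rparr>"

datatype 's action = Push 's | Pop | Stay

text \<open>A transition \<open>(q, l, d, g, act, q')\<close> of the second stage leads from state \<open>q\<close> to state \<open>q'\<close>
  and performs \<open>act\<close> on the pushdown stack. It reads the letter \<open>a\<close> if \<open>l = Some a\<close> and reads
  nothing if \<open>l = None\<close>. It is applicable if \<open>g\<close> is the top symbol of the pushdown stack and \<open>d\<close>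
  is the symbol at the same height on the check stack; here \<open>None\<close> stands for the absence of a
  symbol (empty pushdown stack, respectively no check stack symbol at that height).
  A transition \<open>(q, d, q')\<close> of the first stage pushes \<open>d\<close> onto the check stack.\<close>

record ('q, 'a, 's) cspda =
  states :: "'q set"
  input :: "'a set"
  check_alphabet :: "'s set"
  pushdown_alphabet :: "'s set"
  start :: 'q
  accepting :: "'q set"
  init_trans :: "('q \<times> 's \<times> 'q) set"
  trans :: "('q \<times> 'a option \<times> 's option \<times> 's option \<times> 's action \<times> 'q) set"

definition is_cspda :: "('q, 'a, 's) cspda \<Rightarrow> bool" where
  "is_cspda M \<longleftrightarrow>
     finite (states M) \<and> finite (input M) \<and>
     finite (check_alphabet M) \<and> finite (pushdown_alphabet M) \<and>
     start M \<in> states M \<and> accepting M \<subseteq> states M \<and>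
     init_trans M \<subseteq> states M \<times> check_alphabet M \<times> states M \<and>
     (\<forall>(q, l, d, g, act, q') \<in> trans M.
        q \<in> states M \<and> set_option l \<subseteq> input M \<and> set_option d \<subseteq> check_alphabet M \<and>
        set_option g \<subseteq> pushdown_alphabet M \<and> set_action act \<subseteq> pushdown_alphabet M \<and>
        q' \<in> states M)"

text \<open>In a configuration \<open>(q, cs, ps)\<close> the check stack \<open>cs\<close> is listed from bottom to top, and the
  pushdown stack \<open>ps\<close> from top to bottom. The bottom symbol of a stack has height \<open>1\<close>.\<close>

type_synonym ('q, 's) config = "'q \<times> 's list \<times> 's list"

definition check_at :: "'s list \<Rightarrow> nat \<Rightarrow> 's option" where
  "check_at cs h = (if 1 \<le> h \<and> h \<le> length cs then Some (cs ! (h - 1)) else None)"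

definition top_of :: "'s list \<Rightarrow> 's option" where
  "top_of ps = (case ps of [] \<Rightarrow> None | g # _ \<Rightarrow> Some g)"

fun apply_action :: "'s action \<Rightarrow> 's list \<Rightarrow> 's list option" where
  "apply_action (Push g) ps = Some (g # ps)"
| "apply_action Pop [] = None"
| "apply_action Pop (_ # ps) = Some ps"
| "apply_action Stay ps = Some ps"

inductive initialised :: "('q, 'a, 's) cspda \<Rightarrow> 'q \<Rightarrow> 's list \<Rightarrow> bool" for M where
  "initialised M (start M) []"
| "initialised M q cs \<Longrightarrow> (q, d, q') \<in> init_trans M \<Longrightarrow> initialised M q' (cs @ [d])"

inductive step ::
  "('q, 'a, 's) cspda \<Rightarrow> ('q, 's) config \<Rightarrow> 'a option \<Rightarrow> ('q, 's) config \<Rightarrow> bool" for M where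
  "(q, l, check_at cs (length ps), top_of ps, act, q') \<in> trans M \<Longrightarrow>
   apply_action act ps = Some ps' \<Longrightarrow> step M (q, cs, ps) l (q', cs, ps')"

inductive run ::
  "('q, 'a, 's) cspda \<Rightarrow> ('q, 's) config \<Rightarrow> 'a list \<Rightarrow> ('q, 's) config \<Rightarrow> bool" for M where
  "run M C [] C"
| "step M C None D \<Longrightarrow> run M D w E \<Longrightarrow> run M C w E"
| "step M C (Some a) D \<Longrightarrow> run M D w E \<Longrightarrow> run M C (a # w) E"

definition accepting_config :: "('q, 'a, 's) cspda \<Rightarrow> ('q, 's) config \<Rightarrow> bool" where
  "accepting_config M C \<longleftrightarrow> fst C \<in> accepting M"

text \<open>The first stage may end in any initialised configuration.\<close>

definition language :: "('q, 'a, 's) cspda \<Rightarrow> 'a list set" where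
  "language M = {w \<in> lists (input M).
     \<exists>q cs D. initialised M q cs \<and> run M (q, cs, []) w D \<and> accepting_config M D}"

text \<open>A state without out-transitions is a reading state, vacuously. Transitions of the first stage
  do not read input.\<close>

definition reading_state :: "('q, 'a, 's) cspda \<Rightarrow> 'q \<Rightarrow> bool" where
  "reading_state M q \<longleftrightarrow> q \<in> states M \<and> (\<forall>d q'. (q, d, q') \<notin> init_trans M) \<and>
     (\<forall>l d g act q'. (q, l, d, g, act, q') \<in> trans M \<longrightarrow> l \<noteq> None)"

definition nonreading_state :: "('q, 'a, 's) cspda \<Rightarrow> 'q \<Rightarrow> bool" where
  "nonreading_state M q \<longleftrightarrow> q \<in> states M \<and>
     (\<forall>l d g act q'. (q, l, d, g, act, q') \<in> trans M \<longrightarrow> l = None)"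

definition reading_config :: "('q, 'a, 's) cspda \<Rightarrow> ('q, 's) config \<Rightarrow> bool" where
  "reading_config M C \<longleftrightarrow> reading_state M (fst C)"

definition entry_config :: "('q, 'a, 's) cspda \<Rightarrow> ('q, 's) config \<Rightarrow> bool" where
  "entry_config M C \<longleftrightarrow> (\<exists>q cs l. initialised M q cs \<and> step M (q, cs, []) l C)"

definition entry_state :: "('q, 'a, 's) cspda \<Rightarrow> 'q \<Rightarrow> bool" where
  "entry_state M q \<longleftrightarrow> (\<exists>C. entry_config M C \<and> fst C = q)"

definition failing_config :: "('q, 'a, 's) cspda \<Rightarrow> ('q, 's) config \<Rightarrow> bool" where
  "failing_config M C \<longleftrightarrow> reading_config M C \<and> \<not> accepting_config M C \<and>
     \<not> (\<exists>w D. run M C w D \<and> accepting_config M D)"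

text \<open>\<open>reaches M C w D\<close> means \<open>D = C\<^sup>w\<close>. All transitions from a reading state read a letter, so a
  reading configuration reached after reading \<open>w\<close> is the first such configuration.\<close>

definition reaches ::
  "('q, 'a, 's) cspda \<Rightarrow> ('q, 's) config \<Rightarrow> 'a list \<Rightarrow> ('q, 's) config \<Rightarrow> bool" where
  "reaches M C w D \<longleftrightarrow> run M C w D \<and> reading_config M D"

definition gets_stuck :: "('q, 'a, 's) cspda \<Rightarrow> ('q, 's) config \<Rightarrow> 'a list \<Rightarrow> bool" where
  "gets_stuck M C w \<longleftrightarrow> (\<exists>u v D. w = u @ v \<and> run M C u D \<and>
     \<not> (v = [] \<and> reading_config M D) \<and>
     (\<nexists>E. step M D None E) \<and> (v \<noteq> [] \<longrightarrow> (\<nexists>E. step M D (Some (hd v)) E)))"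

definition fails :: "('q, 'a, 's) cspda \<Rightarrow> ('q, 's) config \<Rightarrow> 'a list \<Rightarrow> bool" where
  "fails M C w \<longleftrightarrow>
     (\<exists>u v D. w = u @ v \<and> run M C u D \<and> failing_config M D) \<or> gets_stuck M C w"

text \<open>The stack symbols include the letters of the input alphabet. The constructor \<open>Aux\<close> supplies
  arbitrarily many further symbols, so finite alphabets containing the letters and markers can all
  be represented up to renaming.\<close>

datatype 'a stack_symbol = Letter 'a | Bottom | Padding | Top | Aux nat

definition deterministic :: "('q, 'a, 's) cspda \<Rightarrow> bool" where
  "deterministic M \<longleftrightarrow>
     (\<forall>q l l' d g act act' q1 q2.
        (q, l, d, g, act, q1) \<in> trans M \<and> (q, l', d, g, act', q2) \<in> trans M \<and>
        (l = l' \<or> l = None \<or> l' = None) \<longrightarrow> l = l' \<and> act = act' \<and> q1 = q2)"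

definition P1 :: "('q, 'a, 's) cspda \<Rightarrow> bool" where
  "P1 M \<longleftrightarrow> (\<forall>q \<in> states M. reading_state M q \<or> nonreading_state M q)"

definition P2 :: "('q, 'a, 's) cspda \<Rightarrow> bool" where
  "P2 M \<longleftrightarrow> deterministic M"

text \<open>The first transition of the second stage reads no input, since an entry configuration is
  one in which the whole input word is still to be read.\<close>

definition P3 :: "('q, 'a, 'a stack_symbol) cspda \<Rightarrow> bool" where
  "P3 M \<longleftrightarrow>
     {Bottom, Padding, Top} \<subseteq> check_alphabet M \<and> {Bottom, Padding} \<subseteq> pushdown_alphabet M \<and>
     (\<forall>q cs l C. initialised M q cs \<and> step M (q, cs, []) l C \<longrightarrow>
        (\<exists>ds. cs = Bottom # ds @ [Top] \<and> Bottom \<notin> set ds \<and> Top \<notin> set ds) \<and>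
        l = None \<and> snd (snd C) = [Bottom] \<and> reading_config M C) \<and>
     (\<forall>q l d g q'. (q, l, d, g, Push Bottom, q') \<in> trans M \<longrightarrow> g = None) \<and>
     (\<forall>q l d g q'. (q, l, d, g, Push Top, q') \<notin> trans M) \<and>
     (\<forall>q l d q'. (q, l, d, Some Bottom, Pop, q') \<notin> trans M) \<and>
     (\<forall>q l g s q'. (q, l, Some Top, g, Push s, q') \<notin> trans M)"

definition P4 :: "('q, 'a, 's) cspda \<Rightarrow> bool" where
  "P4 M \<longleftrightarrow>
     \<not> (\<exists>q cs w (f :: nat \<Rightarrow> ('q, 's) config).
           initialised M q cs \<and> run M (q, cs, []) w (f 0) \<and> (\<forall>i. step M (f i) None (f (Suc i))))"

definition P5 :: "('q, 'a, 's) cspda \<Rightarrow> bool" where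
  "P5 M \<longleftrightarrow> (\<forall>q \<in> accepting M. reading_state M q)"

definition P6 :: "('q, 'a, 's) cspda \<Rightarrow> bool" where
  "P6 M \<longleftrightarrow>
     (\<forall>C u v. entry_config M C \<and> u \<in> lists (input M) \<and> v \<in> lists (input M) \<and>
        v \<notin> language M \<longrightarrow>
        (\<exists>D. reaches M C u D \<and> reaches M C (u @ v) D) \<or> fails M C (u @ v))"

definition P7 :: "('q, 'a, 's) cspda \<Rightarrow> bool" where
  "P7 M \<longleftrightarrow> accepting M = {q. reading_state M q \<and> \<not> entry_state M q}"

definition special_cspda :: "('q, 'a, 'a stack_symbol) cspda \<Rightarrow> bool" where
  "special_cspda M \<longleftrightarrow> is_cspda M \<and> P1 M \<and> P2 M \<and> P3 M \<and> P4 M \<and> P5 M \<and> P6 M \<and> P7 M"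

definition word_value :: "('g, 'b) monoid_scheme \<Rightarrow> 'g list \<Rightarrow> 'g" where
  "word_value G w = foldr (mult G) w \<one>\<^bsub>G\<^esub>"

definition coWP :: "('g, 'b) monoid_scheme \<Rightarrow> 'g set \<Rightarrow> 'g list set" where
  "coWP G A = {w \<in> lists A. word_value G w \<noteq> \<one>\<^bsub>G\<^esub>}"

text \<open>Finite state sets can be taken to consist of natural numbers. Finite generation of \<open>G\<close> is
  part of the condition on \<open>A\<close>.\<close>

definition special_coET0L_group :: "('g, 'b) monoid_scheme \<Rightarrow> bool" where
  "special_coET0L_group G \<longleftrightarrow> group G \<and>
     (\<exists>A. finite A \<and> A \<subseteq> carrier G \<and> (\<forall>a \<in> A. inv\<^bsub>G\<^esub> a \<in> A) \<and> generate G A = carrier G \<and>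
       (\<exists>M :: (nat, 'g, 'g stack_symbol) cspda.
          special_cspda M \<and> input M = A \<and>
          Letter ` A \<subseteq> check_alphabet M \<and> Letter ` A \<subseteq> pushdown_alphabet M \<and>
          language M = coWP G A))"

end

theory Submission
  imports Defs "HOL-Library.Sublist" "HOL-Library.Countable_Set"
begin

text \<open>Every element of \<open>G\<^sub>n\<^sub>,\<^sub>r\<close> rewrites, for a suitable \<open>L\<close>, the prefix of length \<open>L\<close> of an infinite
  string. The group is generated by the bijections between complete antichains obtained from \<open>Q\<close>
  by at most four expansions \<open>b \<mapsto> b\<sigma>\<^sub>1, \<dots>, b\<sigma>\<^sub>n\<close>: between larger antichains, a bijection
  factors through an antichain with three disjoint carets into bijections that carry a caret to a
  caret, and these are bijections between antichains with one expansion less.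

  The machine guesses a prefix \<open>x\<close> of an infinite string, with first letter uppermost and followed
  by enough padding, on the check stack, and applies the input letters to \<open>x\<close> on the pushdown stack.
  Each pushdown letter carries a flag saying whether everything below it agrees with the check stack,
  so when the first letter of the current string has been written the machine knows whether this
  string is \<open>x\<close>; it then returns to the entry configuration, and otherwise it accepts. As the
  configuration is a function of the current string, a word that represents the identity leaves it
  unchanged unless the computation gets stuck.\<close>

section \<open>Prefix exchanges and the Higman-Thompson group\<close>

text \<open>A check symbol is visible only from its own height, and the head moves down only by
  popping, so a string once written cannot be compared with the guess without destroying it. Hence
  the comparison is made while writing, at the cost of one bit per letter. That this bit settles
  equality rests on the disjointness of \<open>Q\<close> and \<open>\<Sigma>\<close>: no proper
  suffix of a string in question begins with a letter of \<open>Q\<close>. P6 with \<open>u\<close>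
  empty asks that a trivial word lead back to the very entry configuration, whose pushdown stack
  holds only \<open>Bottom\<close> by P3. So the guess cannot stay on the pushdown stack and is
  copied anew each time a letter is read there. A guess that is too short, or has too little
  padding, makes the computation stuck, which P6 permits; acceptance needs just one adequate guess.
  The bound four comes from the three carets: in the worst case of one root and two letters,
  \<open>k - 2\<close> expansions leave \<open>k - 1\<close> leaves, and three leaves are to be
  expanded to reach \<open>k + 1\<close> expansions.\<close>

lemma shift_eq_length: "length b = length c \<Longrightarrow> b @- s = c @- t \<longleftrightarrow> b = c \<and> s = t"
  by (induction b c rule: list_induct2) auto

lemma shift_same [simp]: "b @- s = b @- t \<longleftrightarrow> s = t"
  by (simp add: shift_eq_length)

lemma shift_eqD:
  assumes "b @- s = c @- t" "length b \<le> length c"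
  obtains u where "c = b @ u" "s = u @- t"
proof
  have "b @- s = take (length b) c @- (drop (length b) c @- t)"
    using assms(1) by (simp flip: shift_append)
  then have *: "b = take (length b) c \<and> s = drop (length b) c @- t"
    using assms(2) by (subst (asm) shift_eq_length) auto
  then show "c = b @ drop (length b) c" "s = drop (length b) c @- t"
    by (metis append_take_drop_id) (use * in blast)
qed

locale ht =
  fixes Q \<Sigma> :: "'x set"
  assumes finite_Q: "finite Q" and Q_nonempty: "Q \<noteq> {}"
    and finite_Sigma: "finite \<Sigma>" and card_Sigma: "2 \<le> card \<Sigma>"
    and disjoint: "Q \<inter> \<Sigma> = {}"
begin

abbreviation "\<Omega> \<equiv> inf_strings Q \<Sigma>"
abbreviation "W \<equiv> fin_strings Q \<Sigma>"
abbreviation "HT \<equiv> higman_thompson Q \<Sigma>"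

lemma Sigma_nonempty: "\<Sigma> \<noteq> {}"
  using card_Sigma by auto

lemma other_letter: obtains \<sigma> where "\<sigma> \<in> \<Sigma>" "\<sigma> \<noteq> y"
proof -
  have "\<not> \<Sigma> \<subseteq> {y}"
    using card_Sigma card_mono[of "{y}" \<Sigma>] by fastforce
  then show ?thesis using that by blast
qed

lemma stream_ex: obtains \<tau> where "\<tau> \<in> streams \<Sigma>"
proof -
  obtain \<sigma> where "\<sigma> \<in> \<Sigma>" using Sigma_nonempty by blast
  then show ?thesis using that[of "sconst \<sigma>"] by (simp add: streams_iff_sset)
qed

lemma W_nonempty_string: "b \<in> W \<Longrightarrow> b \<noteq> []"
  by (auto simp: fin_strings_def)

lemma Cons_in_W: "x # u \<in> W \<longleftrightarrow> x \<in> Q \<and> u \<in> lists \<Sigma>"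
  by (auto simp: fin_strings_def)

lemma append_in_W: "b \<noteq> [] \<Longrightarrow> b @ u \<in> W \<longleftrightarrow> b \<in> W \<and> u \<in> lists \<Sigma>"
  by (cases b) (auto simp: Cons_in_W)

lemma append_in_WI: "b \<in> W \<Longrightarrow> u \<in> lists \<Sigma> \<Longrightarrow> b @ u \<in> W"
  using append_in_W W_nonempty_string by blast

lemma shift_in_\<Omega>: "b \<noteq> [] \<Longrightarrow> b @- \<tau> \<in> \<Omega> \<longleftrightarrow> b \<in> W \<and> \<tau> \<in> streams \<Sigma>"
  by (cases b) (auto simp: inf_strings_def Cons_in_W streams_iff_sset)

lemma shift_in_\<Omega>I: "b \<in> W \<Longrightarrow> \<tau> \<in> streams \<Sigma> \<Longrightarrow> b @- \<tau> \<in> \<Omega>"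
  using shift_in_\<Omega> W_nonempty_string by blast

lemma \<Omega>_split:
  assumes "\<omega> \<in> \<Omega>" "1 \<le> n"
  obtains p \<tau> where "\<omega> = p @- \<tau>" "p \<in> W" "length p = n" "\<tau> \<in> streams \<Sigma>"
proof
  show *: "\<omega> = stake n \<omega> @- sdrop n \<omega>" by (simp add: stake_sdrop)
  show "length (stake n \<omega>) = n" by simp
  then have "stake n \<omega> \<noteq> []" using assms(2) by auto
  then show "stake n \<omega> \<in> W" "sdrop n \<omega> \<in> streams \<Sigma>"
    using shift_in_\<Omega> * assms(1) by metis+
qed

text \<open>If \<open>c'\<close> were \<open>c @ y # u'\<close>, every tail in
  \<open>streams \<Sigma>\<close> would begin with \<open>y\<close>, but \<open>\<Sigma>\<close> has
  a second letter. Equality on all tails thus becomes equality of strings, which is how relations in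
  the group reach the configurations of the machine.\<close>

lemma string_determined:
  assumes "c \<in> W" "c' \<in> W" "\<And>\<tau>. \<tau> \<in> streams \<Sigma> \<Longrightarrow> c @- \<tau> = c' @- \<tau>"
  shows "c = c'"
proof -
  have *: "c = c'" if eq: "\<And>\<tau>. \<tau> \<in> streams \<Sigma> \<Longrightarrow> c @- \<tau> = c' @- \<tau>"
    and le: "length c \<le> length c'" for c c'
  proof -
    obtain \<tau> where \<tau>: "\<tau> \<in> streams \<Sigma>" by (rule stream_ex)
    obtain u where u: "c' = c @ u" using shift_eqD[OF eq[OF \<tau>] le] by blast
    show ?thesis
    proof (cases u)
      case (Cons y u')
      obtain \<sigma> where \<sigma>: "\<sigma> \<in> \<Sigma>" "\<sigma> \<noteq> y" by (rule other_letter)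
      then have "c @- (\<sigma> ## \<tau>) = c' @- (\<sigma> ## \<tau>)" using eq[of "\<sigma> ## \<tau>"] \<tau> \<sigma> by simp
      then show ?thesis using u Cons \<sigma> by simp
    qed (use u in simp)
  qed
  show ?thesis
    using assms(3) *[of c c'] *[of c' c] by (cases "length c \<le> length c'") auto
qed

definition level :: "nat \<Rightarrow> 'x list set" where
  "level n = {p \<in> W. length p = n}"

lemma finite_level: "finite (level n)"
proof -
  have "level n \<subseteq> {u. set u \<subseteq> Q \<union> \<Sigma> \<and> length u = n}"
    by (auto simp: level_def fin_strings_def)
  then show ?thesis
    using finite_lists_length_eq finite_Q finite_Sigma finite_subset by (metis finite_UnI)
qed

section \<open>Complete antichains and prefix exchanges\<close>

lemma antichain_unique:
  assumes "complete_antichain Q \<Sigma> B" "b \<in> B" "b' \<in> B" "b @- \<tau> = b' @- \<tau>'" "\<tau> \<in> streams \<Sigma>"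
  shows "b = b'"
proof -
  have "b @- \<tau> \<in> \<Omega>"
    using assms(1,2,5) by (auto intro!: shift_in_\<Omega>I simp: complete_antichain_def)
  moreover have "is_prefix b (b @- \<tau>)" "is_prefix b' (b @- \<tau>)"
    unfolding is_prefix_def using assms(4) by metis+
  ultimately show ?thesis
    using assms(1-3) unfolding complete_antichain_def by metis
qed

lemma antichain_split:
  assumes "complete_antichain Q \<Sigma> B" "\<omega> \<in> \<Omega>"
  obtains b \<tau> where "b \<in> B" "\<omega> = b @- \<tau>" "\<tau> \<in> streams \<Sigma>"
proof -
  obtain b where b: "b \<in> B" "is_prefix b \<omega>"
    using assms unfolding complete_antichain_def by metis
  then obtain \<tau> where \<tau>: "\<omega> = b @- \<tau>" unfolding is_prefix_def by blast
  have "b \<in> W" using assms b by (auto simp: complete_antichain_def)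
  then show ?thesis using that b \<tau> assms(2) shift_in_\<Omega> W_nonempty_string by metis
qed

lemma complete_antichainI:
  assumes "finite B" "B \<subseteq> W"
    and "\<And>\<omega>. \<omega> \<in> \<Omega> \<Longrightarrow> \<exists>b \<in> B. \<exists>\<tau>. \<omega> = b @- \<tau>"
    and "\<And>b b' \<tau> \<tau>'. b \<in> B \<Longrightarrow> b' \<in> B \<Longrightarrow> \<tau> \<in> streams \<Sigma> \<Longrightarrow> b @- \<tau> = b' @- \<tau>' \<Longrightarrow> b = b'"
  shows "complete_antichain Q \<Sigma> B"
  unfolding complete_antichain_def is_prefix_def
proof (intro conjI ballI assms(1,2))
  fix \<omega> assume \<omega>: "\<omega> \<in> \<Omega>"
  obtain b \<tau> where b: "b \<in> B" "\<omega> = b @- \<tau>" using assms(3)[OF \<omega>] by blast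
  show "\<exists>!b. b \<in> B \<and> (\<exists>\<tau>. \<omega> = b @- \<tau>)"
  proof (rule ex1I)
    show "b \<in> B \<and> (\<exists>\<tau>. \<omega> = b @- \<tau>)" using b by blast
    fix b' assume b': "b' \<in> B \<and> (\<exists>\<tau>. \<omega> = b' @- \<tau>)"
    have "b \<noteq> []" using b assms(2) W_nonempty_string by blast
    then have "\<tau> \<in> streams \<Sigma>" using \<omega> b shift_in_\<Omega> by blast
    then show "b' = b" using assms(4)[of b b' \<tau>] b b' by metis
  qed
qed

lemma prefix_exchange_apply:
  assumes "complete_antichain Q \<Sigma> B" "b \<in> B" "\<tau> \<in> streams \<Sigma>"
  shows "prefix_exchange Q \<Sigma> B \<phi> (b @- \<tau>) = \<phi> b @- \<tau>"
proof -
  have \<Omega>: "b @- \<tau> \<in> \<Omega>"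
    using assms by (auto intro!: shift_in_\<Omega>I simp: complete_antichain_def)
  have "(THE b'. b' \<in> B \<and> is_prefix b' (b @- \<tau>)) = b"
  proof (rule the_equality)
    show "b \<in> B \<and> is_prefix b (b @- \<tau>)" using assms(2) by (auto simp: is_prefix_def)
    show "b' = b" if "b' \<in> B \<and> is_prefix b' (b @- \<tau>)" for b'
      using that antichain_unique[OF assms(1,2) _ _ assms(3)] unfolding is_prefix_def by metis
  qed
  then show ?thesis
    using \<Omega> by (simp add: prefix_exchange_def Let_def sdrop_shift)
qed

lemma prefix_exchange_extensional: "prefix_exchange Q \<Sigma> B \<phi> \<in> extensional \<Omega>"
  unfolding prefix_exchange_def by simp

lemma prefix_exchange_eqI:
  assumes "f \<in> extensional \<Omega>" "complete_antichain Q \<Sigma> B"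
    and "\<And>b \<tau>. b \<in> B \<Longrightarrow> \<tau> \<in> streams \<Sigma> \<Longrightarrow> f (b @- \<tau>) = \<phi> b @- \<tau>"
  shows "f = prefix_exchange Q \<Sigma> B \<phi>"
proof (rule extensionalityI[OF assms(1) prefix_exchange_extensional])
  fix \<omega> assume "\<omega> \<in> \<Omega>"
  then show "f \<omega> = prefix_exchange Q \<Sigma> B \<phi> \<omega>"
    using antichain_split[OF assms(2)] assms(3) prefix_exchange_apply[OF assms(2)] by metis
qed

lemma prefix_exchange_bij:
  assumes B: "complete_antichain Q \<Sigma> B" and C: "complete_antichain Q \<Sigma> C" and "bij_betw \<phi> B C"
  shows "bij_betw (prefix_exchange Q \<Sigma> B \<phi>) \<Omega> \<Omega>"
proof -
  let ?f = "prefix_exchange Q \<Sigma> B \<phi>"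
  have CW: "C \<subseteq> W" and BW: "B \<subseteq> W" using B C by (auto simp: complete_antichain_def)
  have "inj_on ?f \<Omega>"
  proof (rule inj_onI)
    fix \<omega> \<omega>' assume *: "\<omega> \<in> \<Omega>" "\<omega>' \<in> \<Omega>" "?f \<omega> = ?f \<omega>'"
    obtain b \<tau> where b: "b \<in> B" "\<omega> = b @- \<tau>" "\<tau> \<in> streams \<Sigma>" using antichain_split[OF B *(1)] .
    obtain b' \<tau>' where b': "b' \<in> B" "\<omega>' = b' @- \<tau>'" "\<tau>' \<in> streams \<Sigma>"
      using antichain_split[OF B *(2)] .
    have eq: "\<phi> b @- \<tau> = \<phi> b' @- \<tau>'" using * b b' prefix_exchange_apply[OF B] by metis
    moreover have "\<phi> b \<in> C" "\<phi> b' \<in> C" using assms(3) b b' by (auto simp: bij_betw_def)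
    ultimately have "\<phi> b = \<phi> b'" using antichain_unique[OF C] b by blast
    then have "b = b'" using assms(3) b b' by (meson bij_betw_def inj_onD)
    then show "\<omega> = \<omega>'" using eq b b' by simp
  qed
  moreover have "?f ` \<Omega> = \<Omega>"
  proof (intro equalityI subsetI)
    fix \<omega> assume "\<omega> \<in> ?f ` \<Omega>"
    then obtain \<omega>' where *: "\<omega>' \<in> \<Omega>" "\<omega> = ?f \<omega>'" by blast
    obtain b \<tau> where b: "b \<in> B" "\<omega>' = b @- \<tau>" "\<tau> \<in> streams \<Sigma>" using antichain_split[OF B *(1)] .
    then have "\<phi> b \<in> W" using assms(3) CW by (auto simp: bij_betw_def)
    then show "\<omega> \<in> \<Omega>" using * b prefix_exchange_apply[OF B] shift_in_\<Omega>I by metis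
  next
    fix \<omega> assume \<omega>: "\<omega> \<in> \<Omega>"
    obtain c \<tau> where c: "c \<in> C" "\<omega> = c @- \<tau>" "\<tau> \<in> streams \<Sigma>" using antichain_split[OF C \<omega>] .
    obtain b where b: "b \<in> B" "\<phi> b = c" using assms(3) c by (auto simp: bij_betw_def)
    then have "?f (b @- \<tau>) = \<omega>" "b @- \<tau> \<in> \<Omega>"
      using c prefix_exchange_apply[OF B] shift_in_\<Omega>I BW by auto
    then show "\<omega> \<in> ?f ` \<Omega>" by blast
  qed
  ultimately show ?thesis unfolding bij_betw_def by blast
qed

text \<open>Elements given on different antichains need a common refinement before they can be
  composed. With a single length in place of an antichain, composition just adds the lengths. The
  machine uses the same form for its rewriting table.\<close>

definition rewrites_level :: "nat \<Rightarrow> ('x stream \<Rightarrow> 'x stream) \<Rightarrow> bool" where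
  "rewrites_level L f \<longleftrightarrow>
     1 \<le> L \<and> (\<forall>p \<in> level L. \<exists>c \<in> W. \<forall>\<tau> \<in> streams \<Sigma>. f (p @- \<tau>) = c @- \<tau>)"

text \<open>Letters beyond the first \<open>L\<close> are carried along unchanged. The lower bound
  on \<open>length c\<close> records how many letters survive, so that a second map still finds
  enough of them.\<close>

lemma rewrites_levelE:
  assumes "rewrites_level L f" "p \<in> W" "L \<le> length p"
  obtains c where "c \<in> W" "length p - L < length c"
    "\<And>\<tau>. \<tau> \<in> streams \<Sigma> \<Longrightarrow> f (p @- \<tau>) = c @- \<tau>"
proof -
  let ?b = "take L p" and ?u = "drop L p"
  have L: "1 \<le> L" using assms(1) by (simp add: rewrites_level_def)
  have "?b \<noteq> []" using L W_nonempty_string[OF assms(2)] by auto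
  then have bu: "?b \<in> W" "?u \<in> lists \<Sigma>"
    using append_in_W[of ?b ?u] assms(2) by auto
  then have "?b \<in> level L" using assms(3) by (simp add: level_def)
  then obtain c where c: "c \<in> W" "\<And>\<tau>. \<tau> \<in> streams \<Sigma> \<Longrightarrow> f (?b @- \<tau>) = c @- \<tau>"
    using assms(1) unfolding rewrites_level_def by blast
  have "f (p @- \<tau>) = (c @ ?u) @- \<tau>" if "\<tau> \<in> streams \<Sigma>" for \<tau>
  proof -
    have "f (p @- \<tau>) = f (?b @- (?u @- \<tau>))"
      by (metis append_take_drop_id shift_append)
    also have "\<dots> = c @- (?u @- \<tau>)"
      using that bu by (intro c(2)) (auto simp: streams_iff_sset)
    finally show ?thesis by simp
  qed
  moreover have "c @ ?u \<in> W" using append_in_WI c bu by blast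
  moreover have "length p - L < length (c @ ?u)" using c W_nonempty_string by auto
  ultimately show ?thesis using that by blast
qed

lemma rewrites_level_mono:
  assumes "rewrites_level L f" "L \<le> L'"
  shows "rewrites_level L' f"
  unfolding rewrites_level_def
proof (intro conjI ballI)
  fix p assume "p \<in> level L'"
  then obtain c where "c \<in> W" "\<And>\<tau>. \<tau> \<in> streams \<Sigma> \<Longrightarrow> f (p @- \<tau>) = c @- \<tau>"
    using rewrites_levelE[OF assms(1), of p] assms(2) unfolding level_def by blast
  then show "\<exists>c\<in>W. \<forall>\<tau>\<in>streams \<Sigma>. f (p @- \<tau>) = c @- \<tau>" by blast
qed (use assms in \<open>auto simp: rewrites_level_def\<close>)

text \<open>Every string longer than all elements of a complete antichain extends one of them. In
  the other direction the strings of length \<open>L\<close> form a complete antichain, and since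
  \<open>f\<close> is a bijection of \<open>\<Omega>\<close>, so do the strings that replace
  them.\<close>

lemma carrier_HT_iff:
  "f \<in> carrier HT \<longleftrightarrow> f \<in> extensional \<Omega> \<and> bij_betw f \<Omega> \<Omega> \<and> (\<exists>L. rewrites_level L f)"
proof
  assume "f \<in> carrier HT"
  then obtain B C \<phi> where f: "f = prefix_exchange Q \<Sigma> B \<phi>" and B: "complete_antichain Q \<Sigma> B"
    and C: "complete_antichain Q \<Sigma> C" and \<phi>: "bij_betw \<phi> B C"
    unfolding higman_thompson_def by auto
  \<comment> \<open>The successor gives \<open>1 \<le> L\<close> without a look at
    \<open>B\<close>.\<close>
  let ?L = "Suc (Max (length ` B))"
  have finB: "finite B" using B by (simp add: complete_antichain_def)
  have "rewrites_level ?L f"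
    unfolding rewrites_level_def
  proof (intro conjI ballI)
    fix p assume p: "p \<in> level ?L"
    then have pW: "p \<in> W" and lp: "length p = ?L" by (auto simp: level_def)
    \<comment> \<open>Any tail will do: \<open>p\<close> is longer than every element of
      \<open>B\<close>, so the prefix \<open>b\<close> lies inside \<open>p\<close>.\<close>
    obtain \<tau>0 where \<tau>0: "\<tau>0 \<in> streams \<Sigma>" by (rule stream_ex)
    obtain b \<tau>1 where b: "b \<in> B" "p @- \<tau>0 = b @- \<tau>1" "\<tau>1 \<in> streams \<Sigma>"
      using antichain_split[OF B shift_in_\<Omega>I[OF pW \<tau>0]] .
    have "length b \<le> length p" using finB b(1) lp by (simp add: le_SucI)
    then obtain u where u: "p = b @ u" using shift_eqD[OF b(2)[symmetric]] by blast
    have bW: "b \<in> W" and cW: "\<phi> b \<in> W"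
      using b(1) B C \<phi> by (auto simp: complete_antichain_def bij_betw_def)
    then have uS: "u \<in> lists \<Sigma>" using pW u append_in_W W_nonempty_string by blast
    have "f (p @- \<tau>) = (\<phi> b @ u) @- \<tau>" if "\<tau> \<in> streams \<Sigma>" for \<tau>
      using prefix_exchange_apply[OF B b(1), of "u @- \<tau>"] that uS f u
      by (auto simp: streams_iff_sset)
    moreover have "\<phi> b @ u \<in> W" using cW uS append_in_WI by blast
    ultimately show "\<exists>c\<in>W. \<forall>\<tau>\<in>streams \<Sigma>. f (p @- \<tau>) = c @- \<tau>" by blast
  qed simp
  then show "f \<in> extensional \<Omega> \<and> bij_betw f \<Omega> \<Omega> \<and> (\<exists>L. rewrites_level L f)"
    using prefix_exchange_bij[OF B C \<phi>] prefix_exchange_extensional f by blast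
next
  assume "f \<in> extensional \<Omega> \<and> bij_betw f \<Omega> \<Omega> \<and> (\<exists>L. rewrites_level L f)"
  then obtain L where ext: "f \<in> extensional \<Omega>" and bij: "bij_betw f \<Omega> \<Omega>"
    and L: "rewrites_level L f" by blast
  then have "\<forall>p \<in> level L. \<exists>c. c \<in> W \<and> (\<forall>\<tau> \<in> streams \<Sigma>. f (p @- \<tau>) = c @- \<tau>)"
    unfolding rewrites_level_def by blast
  then obtain \<phi> where \<phi>: "\<And>p. p \<in> level L \<Longrightarrow> \<phi> p \<in> W"
    and f\<phi>: "\<And>p \<tau>. p \<in> level L \<Longrightarrow> \<tau> \<in> streams \<Sigma> \<Longrightarrow> f (p @- \<tau>) = \<phi> p @- \<tau>"
    by metis
  have L1: "1 \<le> L" using L by (simp add: rewrites_level_def)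
  have W: "p \<in> W" "length p = L" if "p \<in> level L" for p using that by (auto simp: level_def)
  \<comment> \<open>Injectivity of \<open>f\<close> pulls a clash of images back to \<open>p\<close>
    and \<open>p'\<close>, which have equal length.\<close>
  have inj: "p = p' \<and> \<tau> = \<tau>'" if "p \<in> level L" "p' \<in> level L" "\<tau> \<in> streams \<Sigma>" "\<tau>' \<in> streams \<Sigma>"
    "\<phi> p @- \<tau> = \<phi> p' @- \<tau>'" for p p' \<tau> \<tau>'
  proof -
    have "f (p @- \<tau>) = f (p' @- \<tau>')" using that f\<phi> by metis
    then have "p @- \<tau> = p' @- \<tau>'"
      using bij that W shift_in_\<Omega>I unfolding bij_betw_def by (meson inj_onD)
    then show ?thesis using W that shift_eq_length by metis
  qed
  have B: "complete_antichain Q \<Sigma> (level L)"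
  proof (rule complete_antichainI)
    show "\<exists>b\<in>level L. \<exists>\<tau>. \<omega> = b @- \<tau>" if \<omega>: "\<omega> \<in> \<Omega>" for \<omega>
    proof -
      obtain p \<tau> where "\<omega> = p @- \<tau>" "p \<in> W" "length p = L" by (rule \<Omega>_split[OF \<omega> L1])
      then show ?thesis by (auto simp: level_def)
    qed
  next
    show "b = b'" if "b \<in> level L" "b' \<in> level L" "b @- \<tau> = b' @- \<tau>'" for b b' \<tau> \<tau>'
      using that W(2) shift_eq_length[of b b'] by simp
  qed (auto simp: finite_level W)
  have C: "complete_antichain Q \<Sigma> (\<phi> ` level L)"
  proof (rule complete_antichainI)
    fix \<omega> assume "\<omega> \<in> \<Omega>"
    then obtain \<omega>' where \<omega>': "\<omega>' \<in> \<Omega>" "f \<omega>' = \<omega>"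
      using bij by (metis bij_betw_imp_surj_on imageE)
    show "\<exists>b\<in>\<phi> ` level L. \<exists>\<tau>. \<omega> = b @- \<tau>"
    proof -
      obtain p \<tau> where "p \<in> level L" "\<omega>' = p @- \<tau>" "\<tau> \<in> streams \<Sigma>"
        using antichain_split[OF B \<omega>'(1)] .
      then have "\<omega> = \<phi> p @- \<tau>" using f\<phi> \<omega>'(2) by simp
      then show ?thesis using \<open>p \<in> level L\<close> by blast
    qed
  next
    fix b b' \<tau> \<tau>'
    assume *: "b \<in> \<phi> ` level L" "b' \<in> \<phi> ` level L" "\<tau> \<in> streams \<Sigma>" "b @- \<tau> = b' @- \<tau>'"
    then have "b \<in> W" "b' \<in> W" using \<phi> by auto
    then have "\<tau>' \<in> streams \<Sigma>" using * shift_in_\<Omega> W_nonempty_string by metis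
    moreover obtain p p' where p: "p \<in> level L" "b = \<phi> p" "p' \<in> level L" "b' = \<phi> p'"
      using * by blast
    ultimately have "p = p'" using inj * by simp
    then show "b = b'" using p by simp
  qed (use finite_level \<phi> in auto)
  have "bij_betw \<phi> (level L) (\<phi> ` level L)"
  proof -
    obtain \<tau> where "\<tau> \<in> streams \<Sigma>" by (rule stream_ex)
    then have "inj_on \<phi> (level L)" using inj by (intro inj_onI) simp
    then show ?thesis by (rule inj_on_imp_bij_betw)
  qed
  moreover have "f = prefix_exchange Q \<Sigma> (level L) \<phi>"
    using prefix_exchange_eqI ext B f\<phi> by blast
  ultimately show "f \<in> carrier HT"
    using B C unfolding higman_thompson_def by auto
qed

section \<open>The group structure\<close>

lemma mult_HT: "f \<otimes>\<^bsub>HT\<^esub> g = compose \<Omega> g f" and one_HT: "\<one>\<^bsub>HT\<^esub> = (\<lambda>\<omega> \<in> \<Omega>. \<omega>)"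
  by (simp_all add: higman_thompson_def)

lemma rewrites_level_compose:
  assumes "rewrites_level L f" "rewrites_level L' g"
  shows "rewrites_level (L + L') (compose \<Omega> g f)"
  unfolding rewrites_level_def
proof (intro conjI ballI)
  fix p assume "p \<in> level (L + L')"
  then have p: "p \<in> W" "length p = L + L'" by (auto simp: level_def)
  obtain c where c: "c \<in> W" "length p - L < length c" 
    "\<And>\<tau>. \<tau> \<in> streams \<Sigma> \<Longrightarrow> f (p @- \<tau>) = c @- \<tau>"
    using rewrites_levelE[OF assms(1) p(1)] p(2) by auto
  obtain d where d: "d \<in> W" "\<And>\<tau>. \<tau> \<in> streams \<Sigma> \<Longrightarrow> g (c @- \<tau>) = d @- \<tau>"
    using rewrites_levelE[OF assms(2) c(1)] c(2) p(2) by auto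
  have "compose \<Omega> g f (p @- \<tau>) = d @- \<tau>" if "\<tau> \<in> streams \<Sigma>" for \<tau>
    using that c d p shift_in_\<Omega>I by (simp add: compose_def)
  then show "\<exists>c\<in>W. \<forall>\<tau>\<in>streams \<Sigma>. compose \<Omega> g f (p @- \<tau>) = c @- \<tau>" using d by blast
qed (use assms in \<open>simp add: rewrites_level_def\<close>)

text \<open>By surjectivity some image \<open>\<phi> b\<close> is a prefix of any string
  \<open>p\<close> that is longer than all these images; the inverse replaces that prefix by
  \<open>b\<close>.\<close>

lemma rewrites_level_inverse:
  assumes bij: "bij_betw f \<Omega> \<Omega>" and L: "rewrites_level L f"
  obtains L' where "rewrites_level L' (\<lambda>\<omega> \<in> \<Omega>. inv_into \<Omega> f \<omega>)"
proof -
  have "\<forall>p \<in> level L. \<exists>c. c \<in> W \<and> (\<forall>\<tau> \<in> streams \<Sigma>. f (p @- \<tau>) = c @- \<tau>)" and L1: "1 \<le> L"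
    using L unfolding rewrites_level_def by blast+
  then obtain \<phi> where \<phi>: "\<And>p. p \<in> level L \<Longrightarrow> \<phi> p \<in> W"
    and f\<phi>: "\<And>p \<tau>. p \<in> level L \<Longrightarrow> \<tau> \<in> streams \<Sigma> \<Longrightarrow> f (p @- \<tau>) = \<phi> p @- \<tau>"
    by metis
  let ?L = "Suc (Max (length ` \<phi> ` level L))"
  have "rewrites_level ?L (\<lambda>\<omega> \<in> \<Omega>. inv_into \<Omega> f \<omega>)"
    unfolding rewrites_level_def
  proof (intro conjI ballI)
    fix p assume "p \<in> level ?L"
    then have p: "p \<in> W" "length p = ?L" by (auto simp: level_def)
    obtain \<tau>0 where \<tau>0: "\<tau>0 \<in> streams \<Sigma>" by (rule stream_ex)
    obtain \<omega> where \<omega>: "\<omega> \<in> \<Omega>" "f \<omega> = p @- \<tau>0"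
      using bij shift_in_\<Omega>I[OF p(1) \<tau>0] by (metis bij_betw_def imageE)
    obtain b \<tau>1 where b: "\<omega> = b @- \<tau>1" "b \<in> W" "length b = L" "\<tau>1 \<in> streams \<Sigma>"
      using \<Omega>_split[OF \<omega>(1) L1] .
    then have bL: "b \<in> level L" by (simp add: level_def)
    have "length (\<phi> b) \<le> length p" using bL p(2) finite_level by (simp add: le_SucI)
    moreover have "\<phi> b @- \<tau>1 = p @- \<tau>0" using \<omega>(2) b bL f\<phi> by simp
    ultimately obtain u where u: "p = \<phi> b @ u" using shift_eqD by blast
    then have uS: "u \<in> lists \<Sigma>" using p(1) append_in_W W_nonempty_string \<phi>[OF bL] by blast
    then have buW: "b @ u \<in> W" using b append_in_WI by blast
    have "(\<lambda>\<omega> \<in> \<Omega>. inv_into \<Omega> f \<omega>) (p @- \<tau>) = (b @ u) @- \<tau>" if \<tau>: "\<tau> \<in> streams \<Sigma>" for \<tau>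
    proof -
      have "u @- \<tau> \<in> streams \<Sigma>" using uS \<tau> by (auto simp: streams_iff_sset)
      then have "f ((b @ u) @- \<tau>) = p @- \<tau>" using f\<phi>[OF bL] u by simp
      moreover have "(b @ u) @- \<tau> \<in> \<Omega>" using shift_in_\<Omega>I buW \<tau> by blast
      ultimately have "inv_into \<Omega> f (p @- \<tau>) = (b @ u) @- \<tau>"
        using bij by (metis bij_betw_inv_into_left)
      then show ?thesis using shift_in_\<Omega>I[OF p(1) \<tau>] by simp
    qed
    then show "\<exists>c\<in>W. \<forall>\<tau>\<in>streams \<Sigma>. (\<lambda>\<omega> \<in> \<Omega>. inv_into \<Omega> f \<omega>) (p @- \<tau>) = c @- \<tau>" using buW by blast
  qed simp
  then show ?thesis using that by blast
qed

lemma group_HT: "group HT"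
proof (rule groupI)
  fix f g assume "f \<in> carrier HT" "g \<in> carrier HT"
  then obtain L L' where *: "bij_betw f \<Omega> \<Omega>" "bij_betw g \<Omega> \<Omega>" "rewrites_level L f" "rewrites_level L' g"
    unfolding carrier_HT_iff by blast
  then have "bij_betw (compose \<Omega> g f) \<Omega> \<Omega>" by (meson bij_betw_compose)
  then show "f \<otimes>\<^bsub>HT\<^esub> g \<in> carrier HT"
    unfolding mult_HT carrier_HT_iff using rewrites_level_compose[OF *(3,4)] by auto
next
  show "\<one>\<^bsub>HT\<^esub> \<in> carrier HT"
  proof -
    have "rewrites_level 1 (\<lambda>\<omega> \<in> \<Omega>. \<omega>)"
      unfolding rewrites_level_def level_def using shift_in_\<Omega>I by auto
    moreover have "bij_betw (\<lambda>\<omega> \<in> \<Omega>. \<omega>) \<Omega> \<Omega>" by (simp add: bij_betw_def inj_on_def)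
    ultimately show ?thesis unfolding carrier_HT_iff one_HT by auto
  qed
next
  fix f g h assume *: "f \<in> carrier HT" "g \<in> carrier HT" "h \<in> carrier HT"
  then have "f \<in> \<Omega> \<rightarrow> \<Omega>" by (auto simp: carrier_HT_iff bij_betw_def)
  then show "f \<otimes>\<^bsub>HT\<^esub> g \<otimes>\<^bsub>HT\<^esub> h = f \<otimes>\<^bsub>HT\<^esub> (g \<otimes>\<^bsub>HT\<^esub> h)"
    unfolding mult_HT using compose_assoc by metis
next
  fix f assume "f \<in> carrier HT"
  then have "f \<in> extensional \<Omega>" "f \<in> \<Omega> \<rightarrow> \<Omega>" by (auto simp: carrier_HT_iff bij_betw_def)
  then show "\<one>\<^bsub>HT\<^esub> \<otimes>\<^bsub>HT\<^esub> f = f"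
    unfolding mult_HT one_HT by (simp add: compose_Id)
next
  fix f assume f: "f \<in> carrier HT"
  let ?g = "\<lambda>\<omega> \<in> \<Omega>. inv_into \<Omega> f \<omega>"
  have bij: "bij_betw f \<Omega> \<Omega>" using f carrier_HT_iff by blast
  obtain L where "rewrites_level L ?g"
    using f rewrites_level_inverse unfolding carrier_HT_iff by blast
  moreover have "bij_betw ?g \<Omega> \<Omega>"
    using bij_betw_inv_into[OF bij] by (rule bij_betw_cong[THEN iffD1, rotated]) simp
  ultimately have "?g \<in> carrier HT" unfolding carrier_HT_iff by auto
  moreover have "?g \<otimes>\<^bsub>HT\<^esub> f = \<one>\<^bsub>HT\<^esub>"
    unfolding mult_HT one_HT using bij compose_id_inv_into by (metis bij_betw_def)
  ultimately show "\<exists>g \<in> carrier HT. g \<otimes>\<^bsub>HT\<^esub> f = \<one>\<^bsub>HT\<^esub>" by blast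
qed

end

section \<open>Finite generation\<close>

lemma bij_betw_extend:
  assumes "finite B" "finite D" "card B = card D" "X \<subseteq> B" "inj_on f X" "f ` X \<subseteq> D"
  obtains \<psi> where "bij_betw \<psi> B D" "\<And>x. x \<in> X \<Longrightarrow> \<psi> x = f x"
proof -
  have fin: "finite X" using assms(1,4) finite_subset by blast
  have "card (B - X) = card (D - f ` X)"
    using assms fin by (simp add: card_Diff_subset card_image)
  then obtain h where h: "bij_betw h (B - X) (D - f ` X)"
    using assms finite_same_card_bij[of "B - X" "D - f ` X"] by blast
  let ?\<psi> = "\<lambda>x. if x \<in> X then f x else h x"
  have "bij_betw ?\<psi> X (f ` X)"
    using assms(5) by (auto simp: bij_betw_def inj_on_def)
  moreover have "bij_betw ?\<psi> (B - X) (D - f ` X)"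
    using h by (rule bij_betw_cong[THEN iffD1, rotated]) simp
  ultimately have "bij_betw ?\<psi> (X \<union> (B - X)) (f ` X \<union> (D - f ` X))"
    by (rule bij_betw_combine) blast
  moreover have "X \<union> (B - X) = B" "f ` X \<union> (D - f ` X) = D" using assms by auto
  ultimately show ?thesis using that[of ?\<psi>] by simp
qed

text \<open>Serves to prescribe where the leaves of two carets go. The families
  \<open>\<beta>\<close> and \<open>\<gamma>\<close> may overlap in \<open>B\<close>; there
  \<open>\<beta>\<close> takes precedence, hence the side condition on \<open>\<gamma> s\<close>.
  Disjoint targets keep the combined map injective.\<close>

lemma bij_betw_extend_two_families:
  assumes "finite B" "finite D" "card B = card D"
    and \<beta>: "inj_on \<beta> S" "\<beta> ` S \<subseteq> B" and \<gamma>: "inj_on \<gamma> S" "\<gamma> ` S \<subseteq> B"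
    and \<delta>: "inj_on \<delta> S" "\<delta> ` S \<subseteq> D" and \<epsilon>: "inj_on \<epsilon> S" "\<epsilon> ` S \<subseteq> D"
    and disj: "\<delta> ` S \<inter> \<epsilon> ` S = {}"
  obtains \<psi> where "bij_betw \<psi> B D" "\<And>s. s \<in> S \<Longrightarrow> \<psi> (\<beta> s) = \<delta> s"
    "\<And>s. s \<in> S \<Longrightarrow> \<gamma> s \<notin> \<beta> ` S \<Longrightarrow> \<psi> (\<gamma> s) = \<epsilon> s"
proof -
  define f where "f x = (if x \<in> \<beta> ` S then \<delta> (inv_into S \<beta> x) else \<epsilon> (inv_into S \<gamma> x))" for x
  let ?X = "\<beta> ` S \<union> \<gamma> ` S"
  have f\<beta>: "f (\<beta> s) = \<delta> s" if "s \<in> S" for s using that \<beta> by (simp add: f_def)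
  have f\<gamma>: "f (\<gamma> s) = \<epsilon> s" if "s \<in> S" "\<gamma> s \<notin> \<beta> ` S" for s using that \<gamma> by (simp add: f_def)
  have X: "(\<exists>s \<in> S. x = \<beta> s) \<or> (\<exists>s \<in> S. x = \<gamma> s \<and> \<gamma> s \<notin> \<beta> ` S)" if "x \<in> ?X" for x
    using that by blast
  have "inj_on f ?X"
  proof (rule inj_onI)
    fix x y assume x: "x \<in> ?X" and y: "y \<in> ?X" and eq: "f x = f y"
    have ne: "\<delta> s \<noteq> \<epsilon> t" if "s \<in> S" "t \<in> S" for s t using disj that by blast
    show "x = y"
      using X[OF x] X[OF y]
    proof (elim disjE bexE conjE)
      fix s t assume "s \<in> S" "t \<in> S" "x = \<beta> s" "y = \<beta> t"
      then show ?thesis using eq f\<beta> \<delta>(1) by (metis inj_onD)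
    next
      fix s t assume *: "s \<in> S" "t \<in> S" "x = \<beta> s" "y = \<gamma> t" "\<gamma> t \<notin> \<beta> ` S"
      then have "\<delta> s = \<epsilon> t" using eq f\<beta>[of s] f\<gamma>[of t] by metis
      then show ?thesis using ne * by blast
    next
      fix s t assume *: "s \<in> S" "t \<in> S" "x = \<gamma> s" "y = \<beta> t" "\<gamma> s \<notin> \<beta> ` S"
      then have "\<delta> t = \<epsilon> s" using eq f\<beta>[of t] f\<gamma>[of s] by metis
      then show ?thesis using ne * by blast
    next
      fix s t assume *: "s \<in> S" "t \<in> S" "x = \<gamma> s" "y = \<gamma> t" "\<gamma> s \<notin> \<beta> ` S" "\<gamma> t \<notin> \<beta> ` S"
      then have "\<epsilon> s = \<epsilon> t" using eq f\<gamma>[of s] f\<gamma>[of t] by metis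
      then show ?thesis using * \<epsilon>(1) by (metis inj_onD)
    qed
  qed
  moreover have "f ` ?X \<subseteq> D"
  proof
    fix z assume "z \<in> f ` ?X"
    then obtain x where x: "x \<in> ?X" "z = f x" by blast
    from X[OF x(1)] show "z \<in> D"
    proof (elim disjE bexE conjE)
      fix s assume "s \<in> S" "x = \<beta> s"
      then have "z = \<delta> s" using x f\<beta> by metis
      then show ?thesis using \<delta>(2) \<open>s \<in> S\<close> by blast
    next
      fix s assume "s \<in> S" "x = \<gamma> s" "\<gamma> s \<notin> \<beta> ` S"
      then have "z = \<epsilon> s" using x f\<gamma> by metis
      then show ?thesis using \<epsilon>(2) \<open>s \<in> S\<close> by blast
    qed
  qed
  moreover have "?X \<subseteq> B" using \<beta> \<gamma> by blast
  ultimately obtain \<psi> where \<psi>: "bij_betw \<psi> B D" "\<And>x. x \<in> ?X \<Longrightarrow> \<psi> x = f x"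
    using bij_betw_extend[OF assms(1-3), of ?X f] by metis
  show ?thesis
  proof (rule that[OF \<psi>(1)])
    show "\<psi> (\<beta> s) = \<delta> s" if "s \<in> S" for s
      using \<psi>(2)[of "\<beta> s"] f\<beta>[OF that] that by simp
    show "\<psi> (\<gamma> s) = \<epsilon> s" if "s \<in> S" "\<gamma> s \<notin> \<beta> ` S" for s
      using \<psi>(2)[of "\<gamma> s"] f\<gamma>[OF that] that by simp
  qed
qed

context ht
begin

abbreviation antichain :: "'x list set \<Rightarrow> bool" where "antichain \<equiv> complete_antichain Q \<Sigma>"
abbreviation pex :: "'x list set \<Rightarrow> ('x list \<Rightarrow> 'x list) \<Rightarrow> 'x stream \<Rightarrow> 'x stream" where
  "pex \<equiv> prefix_exchange Q \<Sigma>"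

section \<open>Expansions, carets and forests\<close>

definition caret :: "'x list \<Rightarrow> 'x list set" where
  "caret b = (\<lambda>\<sigma>. b @ [\<sigma>]) ` \<Sigma>"

definition expand :: "'x list \<Rightarrow> 'x list set \<Rightarrow> 'x list set" where
  "expand b B = (B - {b}) \<union> caret b"

lemma antichain_W: "antichain B \<Longrightarrow> b \<in> B \<Longrightarrow> b \<in> W"
  by (auto simp: complete_antichain_def)

lemma antichain_finite: "antichain B \<Longrightarrow> finite B"
  by (simp add: complete_antichain_def)

lemma antichain_append:
  assumes "antichain B" "b \<in> B" "b @ u \<in> B"
  shows "u = []"
proof -
  obtain \<tau> where \<tau>: "\<tau> \<in> streams \<Sigma>" by (rule stream_ex)
  have "b @ u = b"
    using antichain_unique[OF assms(1,3,2), of \<tau> "u @- \<tau>"] \<tau> by simp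
  then show ?thesis by simp
qed

lemma caret_disjoint: "antichain B \<Longrightarrow> b \<in> B \<Longrightarrow> B \<inter> caret b = {}"
  using antichain_append unfolding caret_def by blast

lemma carets_disjoint: "b \<noteq> c \<Longrightarrow> caret b \<inter> caret c = {}"
  by (auto simp: caret_def)

lemma card_caret: "card (caret b) = card \<Sigma>"
  unfolding caret_def by (intro card_image) (simp add: inj_on_def)

lemma card_expand:
  assumes "antichain B" "b \<in> B"
  shows "card (expand b B) = card B + (card \<Sigma> - 1)"
proof -
  have "card (expand b B) = card (B - {b}) + card (caret b)"
    unfolding expand_def using caret_disjoint[OF assms] antichain_finite[OF assms(1)] finite_Sigma
    by (intro card_Un_disjoint) (auto simp: caret_def)
  moreover have "0 < card B" using assms antichain_finite card_gt_0_iff by blast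
  ultimately show ?thesis
    using assms card_Sigma by (simp add: card_caret card_Diff_singleton)
qed

lemma antichain_expand:
  assumes B: "antichain B" and b: "b \<in> B"
  shows "antichain (expand b B)"
proof (rule complete_antichainI)
  show "finite (expand b B)"
    using antichain_finite[OF B] finite_Sigma by (simp add: expand_def caret_def)
  show "expand b B \<subseteq> W"
    using antichain_W[OF B] append_in_WI b by (auto simp: expand_def caret_def)
next
  fix \<omega> assume "\<omega> \<in> \<Omega>"
  then obtain b' \<tau> where b': "b' \<in> B" "\<omega> = b' @- \<tau>" "\<tau> \<in> streams \<Sigma>" by (rule antichain_split[OF B])
  show "\<exists>c\<in>expand b B. \<exists>\<tau>. \<omega> = c @- \<tau>"
  proof (cases "b' = b")
    case True
    have "\<omega> = (b @ [shd \<tau>]) @- stl \<tau>" using b' True by simp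
    moreover have "b @ [shd \<tau>] \<in> expand b B"
      using b'(3) by (cases \<tau>) (auto simp: expand_def caret_def)
    ultimately show ?thesis by blast
  qed (use b' in \<open>auto simp: expand_def\<close>)
next
  fix c c' \<tau> \<tau>'
  assume *: "c \<in> expand b B" "c' \<in> expand b B" "\<tau> \<in> streams \<Sigma>" "c @- \<tau> = c' @- \<tau>'"
  let ?up = "\<lambda>c. if c \<in> B - {b} then c else b"
  have up: "\<exists>u. c = ?up c @ u \<and> set u \<subseteq> \<Sigma> \<and> ?up c \<in> B" if "c \<in> expand b B" for c
    using that b by (auto simp: expand_def caret_def)
  obtain u u' where u: "c = ?up c @ u" "set u \<subseteq> \<Sigma>" "?up c \<in> B"
    and u': "c' = ?up c' @ u'" "?up c' \<in> B" using up[OF *(1)] up[OF *(2)] by blast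
  have "?up c @- (u @- \<tau>) = ?up c' @- (u' @- \<tau>')"
    using *(4) u(1) u'(1) by (metis shift_append)
  moreover have "u @- \<tau> \<in> streams \<Sigma>" using *(3) u(2) by (auto simp: streams_iff_sset)
  ultimately have "?up c = ?up c'" using antichain_unique[OF B u(3) u'(2)] by blast
  then show "c = c'"
    using * by (auto simp: expand_def caret_def split: if_splits)
qed

lemma expand_commute:
  assumes "antichain B" "a \<in> B" "b \<in> B" "a \<noteq> b"
  shows "expand a (expand b B) = expand b (expand a B)"
  using caret_disjoint[OF assms(1,2)] caret_disjoint[OF assms(1,3)] assms
  unfolding expand_def by blast

text \<open>These are the leaf sets of forests with roots \<open>Q\<close> and \<open>k\<close>
  inner nodes, each with \<open>card \<Sigma>\<close> children. The index determines the cardinality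
  and drives the induction for finite generation.\<close>

inductive forest :: "nat \<Rightarrow> 'x list set \<Rightarrow> bool" where
  forest_0: "forest 0 ((\<lambda>q. [q]) ` Q)"
| forest_Suc: "forest k B \<Longrightarrow> b \<in> B \<Longrightarrow> forest (Suc k) (expand b B)"

lemma antichain_roots: "antichain ((\<lambda>q. [q]) ` Q)"
proof (rule complete_antichainI)
  fix \<omega> assume "\<omega> \<in> \<Omega>"
  then have "\<omega> = [shd \<omega>] @- stl \<omega>" "[shd \<omega>] \<in> (\<lambda>q. [q]) ` Q" by (auto simp: inf_strings_def)
  then show "\<exists>b\<in>(\<lambda>q. [q]) ` Q. \<exists>\<tau>. \<omega> = b @- \<tau>" by metis
qed (use finite_Q in \<open>auto simp: Cons_in_W\<close>)

lemma forest_antichain: "forest k B \<Longrightarrow> antichain B"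
  by (induction rule: forest.induct) (simp_all add: antichain_roots antichain_expand)

lemma card_forest: "forest k B \<Longrightarrow> card B = card Q + k * (card \<Sigma> - 1)"
proof (induction rule: forest.induct)
  case forest_0
  show ?case by (simp add: card_image inj_on_def)
qed (simp add: card_expand forest_antichain)

text \<open>The bound is attained with one root and two letters.\<close>

lemma card_forest_ge:
  assumes "forest k B"
  shows "Suc k \<le> card B"
proof -
  have "1 \<le> card Q" using finite_Q Q_nonempty by (simp add: Suc_leI card_gt_0_iff)
  moreover have "k * 1 \<le> k * (card \<Sigma> - 1)" using card_Sigma by (intro mult_le_mono2) simp
  ultimately show ?thesis using card_forest[OF assms] by linarith
qed

lemma forest_ex: "\<exists>B. forest k B"
proof (induction k)
  case (Suc k)
  then obtain B where B: "forest k B" by blast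
  then obtain b where "b \<in> B" using card_forest_ge[OF B] by fastforce
  then show ?case using B forest_Suc by blast
qed (use forest_0 in blast)

lemma finite_forests: "finite {B. forest k B}"
proof (induction k)
  case 0
  have "{B. forest 0 B} \<subseteq> {(\<lambda>q. [q]) ` Q}" by (auto elim: forest.cases)
  then show ?case by (rule finite_subset) simp
next
  case (Suc k)
  have "{B. forest (Suc k) B} \<subseteq> (\<Union>B \<in> {B. forest k B}. (\<lambda>b. expand b B) ` B)"
  proof
    fix B assume "B \<in> {B. forest (Suc k) B}"
    then have "forest (Suc k) B" by simp
    then show "B \<in> (\<Union>B \<in> {B. forest k B}. (\<lambda>b. expand b B) ` B)" by cases auto
  qed
  moreover have "finite (\<Union>B \<in> {B. forest k B}. (\<lambda>b. expand b B) ` B)"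
    using Suc forest_antichain antichain_finite by auto
  ultimately show ?case by (rule finite_subset)
qed

text \<open>The parent \<open>p\<close> of a longest element \<open>b\<close> works. A string that
  continues \<open>p @ [\<sigma>]\<close> has a prefix in \<open>B\<close>. This is no prefix of
  \<open>p\<close>, or else it would be a proper prefix of \<open>b\<close>, and it is not longer
  than \<open>b\<close>; so it is \<open>p @ [\<sigma>]\<close>.\<close>

lemma caret_ex:
  assumes B: "antichain B" and "b0 \<in> B" "2 \<le> length b0"
  obtains p where "p \<in> W" "caret p \<subseteq> B"
proof -
  have "Max (length ` B) \<in> length ` B"
    using antichain_finite[OF B] assms(2) by (intro Max_in) auto
  then obtain b where b: "b \<in> B" "length b = Max (length ` B)" by auto
  have max: "length b' \<le> length b" if "b' \<in> B" for b'
    using that b(2) antichain_finite[OF B] by simp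
  have len: "2 \<le> length b" using max[OF assms(2)] assms(3) by simp
  define p y where "p = butlast b" and "y = last b"
  have "b \<noteq> []" using len by auto
  then have py: "b = p @ [y]" unfolding p_def y_def by simp
  have "length p \<noteq> 0" using len unfolding p_def by simp
  then have "p \<noteq> []" by blast
  then have p: "p \<in> W" using antichain_W[OF B b(1)] append_in_W py by blast
  have "p @ [\<sigma>] \<in> B" if \<sigma>: "\<sigma> \<in> \<Sigma>" for \<sigma>
  proof -
    obtain \<tau> where \<tau>: "\<tau> \<in> streams \<Sigma>" by (rule stream_ex)
    have "p @- (\<sigma> ## \<tau>) \<in> \<Omega>" using p \<tau> \<sigma> by (intro shift_in_\<Omega>I) auto
    then obtain b' \<tau>' where b': "b' \<in> B" "p @- (\<sigma> ## \<tau>) = b' @- \<tau>'" "\<tau>' \<in> streams \<Sigma>"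
      by (rule antichain_split[OF B])
    show ?thesis
    proof (cases "length b' \<le> length p")
      case True
      then obtain u where "p = b' @ u" using shift_eqD[OF b'(2)[symmetric]] by blast
      then have "b' @ (u @ [y]) \<in> B" using b py by simp
      then show ?thesis using antichain_append[OF B b'(1)] by blast
    next
      case False
      then have "length (p @ [\<sigma>]) = length b'" using max[OF b'(1)] py by simp
      moreover have "(p @ [\<sigma>]) @- \<tau> = b' @- \<tau>'" using b'(2) by simp
      ultimately have "p @ [\<sigma>] = b'" using shift_eq_length by blast
      then show ?thesis using b' by simp
    qed
  qed
  then show ?thesis using that p by (auto simp: caret_def)
qed

lemma antichain_collapse:
  assumes B: "antichain B" and p: "p \<in> W" "caret p \<subseteq> B"
  shows "antichain (insert p (B - caret p))" "expand p (insert p (B - caret p)) = B"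
proof -
  let ?B = "insert p (B - caret p)"
  show "antichain ?B"
  proof (rule complete_antichainI)
    show "finite ?B" using antichain_finite[OF B] by simp
    show "?B \<subseteq> W" using antichain_W[OF B] p by blast
  next
    fix \<omega> assume "\<omega> \<in> \<Omega>"
    then obtain b \<tau> where b: "b \<in> B" "\<omega> = b @- \<tau>" "\<tau> \<in> streams \<Sigma>" by (rule antichain_split[OF B])
    show "\<exists>c\<in>?B. \<exists>\<tau>. \<omega> = c @- \<tau>"
    proof (cases "b \<in> caret p")
      case True
      then obtain \<sigma> where "b = p @ [\<sigma>]" by (auto simp: caret_def)
      then have "\<omega> = p @- (\<sigma> ## \<tau>)" using b by simp
      then show ?thesis by blast
    qed (use b in blast)
  next
    fix c c' \<tau> \<tau>' assume *: "c \<in> ?B" "c' \<in> ?B" "\<tau> \<in> streams \<Sigma>" "c @- \<tau> = c' @- \<tau>'"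
    then have W: "c \<in> W" "c' \<in> W" using antichain_W[OF B] p by auto
    then have \<tau>': "\<tau>' \<in> streams \<Sigma>" using * shift_in_\<Omega> W_nonempty_string by metis
    \<comment> \<open>A continuation of \<open>p\<close> starts with an element of the caret of
      \<open>p\<close>, and by uniqueness it has no other prefix in \<open>B\<close>.\<close>
    have key: False if "c \<in> B - caret p" "p @- \<tau>' = c @- \<tau>" "\<tau>' \<in> streams \<Sigma>" for c \<tau> \<tau>'
    proof -
      obtain \<sigma> \<tau>'' where \<sigma>: "\<tau>' = \<sigma> ## \<tau>''" by (cases \<tau>')
      then have \<sigma>S: "\<sigma> \<in> \<Sigma>" "\<tau>'' \<in> streams \<Sigma>" using that(3) by (simp_all add: streams_Stream)
      then have "p @ [\<sigma>] \<in> caret p" by (auto simp: caret_def)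
      moreover have "(p @ [\<sigma>]) @- \<tau>'' = c @- \<tau>" using that(2) \<sigma> by simp
      ultimately have "p @ [\<sigma>] = c" using antichain_unique[OF B _ _ _ \<sigma>S(2)] p(2) that(1) by blast
      then show False using that(1) \<open>p @ [\<sigma>] \<in> caret p\<close> by blast
    qed
    show "c = c'"
    proof (cases "c = p")
      case True
      then show ?thesis using key[of c' \<tau> \<tau>'] * by (cases "c' = p") auto
    next
      case False
      then have c: "c \<in> B - caret p" using * by blast
      show ?thesis
      proof (cases "c' = p")
        case True
        then show ?thesis using key[OF c] \<tau>' *(4) by metis
      next
        case False
        then show ?thesis using antichain_unique[OF B _ _ *(4,3)] c *(2) by blast
      qed
    qed
  qed
  have "p \<notin> B"
  proof
    assume pB: "p \<in> B"
    obtain \<sigma> where "\<sigma> \<in> \<Sigma>" using Sigma_nonempty by blast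
    then have "p @ [\<sigma>] \<in> B" using p(2) by (auto simp: caret_def)
    then show False using antichain_append[OF B pB] by blast
  qed
  then show "expand p ?B = B" using p(2) unfolding expand_def by blast
qed

text \<open>Collapsing a caret lowers the cardinality by \<open>card \<Sigma> - 1 > 0\<close>. Once
  all elements have length one, completeness forces every root to be present.\<close>

lemma antichain_forest: "antichain B \<Longrightarrow> \<exists>k. forest k B"
proof (induction "card B" arbitrary: B rule: less_induct)
  case less
  show ?case
  proof (cases "\<exists>b \<in> B. 2 \<le> length b")
    case True
    then obtain b where b: "b \<in> B" "2 \<le> length b" by blast
    obtain p where p: "p \<in> W" "caret p \<subseteq> B" by (rule caret_ex[OF less.prems b])
    let ?B = "insert p (B - caret p)"
    have B': "antichain ?B" "expand p ?B = B" using antichain_collapse[OF less.prems p] .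
    then have "card B = card ?B + (card \<Sigma> - 1)" using card_expand[of ?B p] by simp
    then have "card ?B < card B" using card_Sigma by simp
    then obtain k where "forest k ?B" using less.hyps B'(1) by blast
    then have "forest (Suc k) (expand p ?B)" by (intro forest_Suc) auto
    then show ?thesis using B'(2) by auto
  next
    case False
    have sub: "B \<subseteq> (\<lambda>q. [q]) ` Q"
    proof
      fix b assume b: "b \<in> B"
      then obtain q u where "b = q # u" "q \<in> Q"
        using antichain_W[OF less.prems b] by (auto simp: fin_strings_def)
      then show "b \<in> (\<lambda>q. [q]) ` Q" using False b by (cases u) force+
    qed
    moreover have "[q] \<in> B" if q: "q \<in> Q" for q
    proof -
      obtain \<tau> where "\<tau> \<in> streams \<Sigma>" by (rule stream_ex)
      then have "[q] @- \<tau> \<in> \<Omega>" using q by (intro shift_in_\<Omega>I) (auto simp: Cons_in_W)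
      then obtain b \<tau>' where b: "b \<in> B" "[q] @- \<tau> = b @- \<tau>'" by (rule antichain_split[OF less.prems])
      then show ?thesis using sub by auto
    qed
    ultimately have "B = (\<lambda>q. [q]) ` Q" by blast
    then show ?thesis using forest_0 by auto
  qed
qed

section \<open>Reducing the number of expansions\<close>

definition exchanges :: "nat \<Rightarrow> ('x stream \<Rightarrow> 'x stream) set" where
  "exchanges k = {pex B \<phi> | B C \<phi>. forest k B \<and> forest k C \<and> bij_betw \<phi> B C}"

lemma pex_cong:
  assumes "antichain B" "\<And>b. b \<in> B \<Longrightarrow> \<phi> b = \<psi> b"
  shows "pex B \<phi> = pex B \<psi>"
  using assms prefix_exchange_apply[OF assms(1)]
  by (intro prefix_exchange_eqI prefix_exchange_extensional) auto

text \<open>Domain and range of a bijection have equally many elements, and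
  \<open>card Q + k * (card \<Sigma> - 1)\<close> determines \<open>k\<close>, so both arise by the
  same number of expansions.\<close>

lemma carrier_HT_exchanges: "carrier HT = (\<Union>k. exchanges k)"
proof (intro equalityI subsetI)
  fix f assume "f \<in> carrier HT"
  then obtain B C \<phi> where f: "f = pex B \<phi>" "antichain B" "antichain C" "bij_betw \<phi> B C"
    unfolding higman_thompson_def by auto
  then obtain k l where kl: "forest k B" "forest l C" using antichain_forest by metis
  have "k * (card \<Sigma> - 1) = l * (card \<Sigma> - 1)"
    using card_forest[OF kl(1)] card_forest[OF kl(2)] bij_betw_same_card[OF f(4)] by linarith
  moreover have "0 < card \<Sigma> - 1" using card_Sigma by simp
  ultimately have "k = l" by (metis less_irrefl_nat mult_cancel2)
  then show "f \<in> (\<Union>k. exchanges k)" using f kl unfolding exchanges_def by blast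
next
  fix f assume "f \<in> (\<Union>k. exchanges k)"
  then obtain k B C \<phi> where f: "f = pex B \<phi>" "forest k B" "forest k C" "bij_betw \<phi> B C"
    unfolding exchanges_def by blast
  then have "antichain B" "antichain C" using forest_antichain by blast+
  then show "f \<in> carrier HT"
    unfolding higman_thompson_def using f by auto
qed

lemma finite_exchanges: "finite (exchanges k)"
proof -
  let ?F = "{B. forest k B}"
  have "exchanges k \<subseteq> (\<Union>B \<in> ?F. \<Union>C \<in> ?F. pex B ` (B \<rightarrow>\<^sub>E C))"
  proof
    fix f assume "f \<in> exchanges k"
    then obtain B C \<phi> where f: "f = pex B \<phi>" "forest k B" "forest k C" "bij_betw \<phi> B C"
      unfolding exchanges_def by blast
    \<comment> \<open>Only the values on \<open>B\<close> matter; after restriction finitely many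
      candidates remain.\<close>
    have "f = pex B (restrict \<phi> B)"
      unfolding f(1) by (rule pex_cong[OF forest_antichain[OF f(2)]]) simp
    moreover have "restrict \<phi> B \<in> B \<rightarrow>\<^sub>E C" using f(4) by (auto simp: bij_betw_def)
    ultimately show "f \<in> (\<Union>B \<in> ?F. \<Union>C \<in> ?F. pex B ` (B \<rightarrow>\<^sub>E C))" using f by blast
  qed
  moreover have "finite (\<Union>B \<in> ?F. \<Union>C \<in> ?F. pex B ` (B \<rightarrow>\<^sub>E C))"
    using finite_forests forest_antichain antichain_finite
    by (intro finite_UN_I finite_imageI finite_PiE) auto
  ultimately show ?thesis by (rule finite_subset)
qed

lemma pex_mult:
  assumes "antichain B" "antichain D" "bij_betw \<psi> B D"
  shows "pex B \<psi> \<otimes>\<^bsub>HT\<^esub> pex D \<theta> = pex B (\<theta> \<circ> \<psi>)"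
  unfolding mult_HT
proof (rule prefix_exchange_eqI[OF compose_extensional assms(1)])
  fix b \<tau> assume b: "b \<in> B" "\<tau> \<in> streams \<Sigma>"
  then have "\<psi> b \<in> D" using assms(3) by (auto simp: bij_betw_def)
  then show "compose \<Omega> (pex D \<theta>) (pex B \<psi>) (b @- \<tau>) = (\<theta> \<circ> \<psi>) b @- \<tau>"
    using b prefix_exchange_apply assms antichain_W shift_in_\<Omega>I by (simp add: compose_def)
qed

text \<open>A map that carries one caret to another letter by letter merely replaces the prefix
  \<open>b\<close> by \<open>c\<close>, so both carets can be collapsed.\<close>

lemma pex_reduce:
  assumes B: "forest k B" "b \<in> B" and C: "forest k C" "c \<in> C"
    and \<phi>: "bij_betw \<phi> (expand b B) (expand c C)" "\<And>\<sigma>. \<sigma> \<in> \<Sigma> \<Longrightarrow> \<phi> (b @ [\<sigma>]) = c @ [\<sigma>]"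
  shows "pex (expand b B) \<phi> \<in> exchanges k"
proof -
  let ?\<psi> = "\<phi>(b := c)"
  have aB: "antichain B" and aC: "antichain C" using B C forest_antichain by auto
  have "bij_betw \<phi> (caret b) (caret c)"
    unfolding bij_betw_def caret_def using \<phi>(2) by (auto simp: inj_on_def image_iff)
  then have "bij_betw \<phi> (expand b B - caret b) (expand c C - caret c)"
    by (intro bij_betw_DiffI[OF \<phi>(1)]) (auto simp: expand_def)
  moreover have "expand b B - caret b = B - {b}" "expand c C - caret c = C - {c}"
    using caret_disjoint[OF aB B(2)] caret_disjoint[OF aC C(2)] unfolding expand_def by blast+
  ultimately have "bij_betw \<phi> (B - {b}) (C - {c})" by simp
  then have "bij_betw ?\<psi> (B - {b}) (C - {c})"
    by (rule bij_betw_cong[THEN iffD1, rotated]) simp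
  then have "bij_betw ?\<psi> ((B - {b}) \<union> {b}) ((C - {c}) \<union> {?\<psi> b})"
    by (intro notIn_Un_bij_betw) auto
  then have "bij_betw ?\<psi> B C" using B(2) C(2) by (simp add: insert_absorb)
  moreover have "pex (expand b B) \<phi> = pex B ?\<psi>"
  proof (rule sym, rule prefix_exchange_eqI[OF prefix_exchange_extensional antichain_expand[OF aB B(2)]])
    fix x \<tau> assume x: "x \<in> expand b B" "\<tau> \<in> streams \<Sigma>"
    show "pex B ?\<psi> (x @- \<tau>) = \<phi> x @- \<tau>"
    proof (cases "x \<in> caret b")
      case True
      then obtain \<sigma> where \<sigma>: "\<sigma> \<in> \<Sigma>" "x = b @ [\<sigma>]" by (auto simp: caret_def)
      then show ?thesis
        using prefix_exchange_apply[OF aB B(2), of "\<sigma> ## \<tau>" ?\<psi>] x \<phi>(2) by simp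
    next
      case False
      then have "x \<in> B" "x \<noteq> b" using x by (auto simp: expand_def)
      then show ?thesis using prefix_exchange_apply[OF aB, of x \<tau>] x by simp
    qed
  qed
  ultimately show ?thesis using B C unfolding exchanges_def by blast
qed

lemma pex_factor:
  assumes "antichain B" "antichain D" "bij_betw \<psi> B D"
  shows "pex B \<phi> = pex B \<psi> \<otimes>\<^bsub>HT\<^esub> pex D (\<phi> \<circ> inv_into B \<psi>)"
  using pex_mult[OF assms, of "\<phi> \<circ> inv_into B \<psi>"] assms
  by (auto intro!: pex_cong simp: bij_betw_def)

text \<open>Chosen so that \<open>\<psi>\<close> reduces along the carets of \<open>b\<close> and
  \<open>d\<close>. The last clause makes the inverse of \<open>\<psi>\<close> followed by
  \<open>\<phi>\<close> carry \<open>e @ [\<sigma>]\<close> to \<open>c @ [\<sigma>]\<close>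
  whenever the preimage of the latter under \<open>\<phi>\<close> is not already bound by the caret
  of \<open>b\<close>.\<close>

lemma caret_transport:
  assumes B: "forest k B" "b \<in> B" and C: "forest k C" "c \<in> C"
    and \<phi>: "bij_betw \<phi> (expand b B) (expand c C)"
    and D: "forest k D" "d \<in> D" and E: "forest k E" "e \<in> E" and de: "expand d D = expand e E" "d \<noteq> e"
  obtains \<psi> where "bij_betw \<psi> (expand b B) (expand d D)"
    "\<And>\<sigma>. \<sigma> \<in> \<Sigma> \<Longrightarrow> \<psi> (b @ [\<sigma>]) = d @ [\<sigma>]"
    "\<And>x \<sigma>. x \<in> expand b B \<Longrightarrow> \<sigma> \<in> \<Sigma> \<Longrightarrow> \<phi> x = c @ [\<sigma>] \<Longrightarrow> x \<notin> caret b \<Longrightarrow> \<psi> x = e @ [\<sigma>]"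
proof -
  let ?B = "expand b B" and ?C = "expand c C" and ?D = "expand d D"
  have f: "forest (Suc k) ?B" "forest (Suc k) ?C" "forest (Suc k) ?D"
    using forest_Suc assms by blast+
  then have fin: "finite ?B" "finite ?D" using forest_antichain antichain_finite by blast+
  have card: "card ?B = card ?D" using card_forest f by metis
  let ?\<gamma> = "\<lambda>\<sigma>. inv_into ?B \<phi> (c @ [\<sigma>])"
  have cC: "c @ [\<sigma>] \<in> ?C" if "\<sigma> \<in> \<Sigma>" for \<sigma> using that by (auto simp: expand_def caret_def)
  have \<gamma>B: "?\<gamma> ` \<Sigma> \<subseteq> ?B" using bij_betw_inv_into[OF \<phi>] cC by (auto simp: bij_betw_def)
  have \<gamma>inj: "inj_on ?\<gamma> \<Sigma>"
    using bij_betw_inv_into[OF \<phi>] cC by (auto simp: bij_betw_def inj_on_def)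
  have sub: "(\<lambda>\<sigma>. b @ [\<sigma>]) ` \<Sigma> \<subseteq> ?B" "(\<lambda>\<sigma>. d @ [\<sigma>]) ` \<Sigma> \<subseteq> ?D" "(\<lambda>\<sigma>. e @ [\<sigma>]) ` \<Sigma> \<subseteq> ?D"
  proof -
    show "(\<lambda>\<sigma>. e @ [\<sigma>]) ` \<Sigma> \<subseteq> ?D" unfolding de(1) by (simp add: expand_def caret_def)
  qed (simp_all add: expand_def caret_def)
  obtain \<psi> where \<psi>: "bij_betw \<psi> ?B ?D" "\<And>\<sigma>. \<sigma> \<in> \<Sigma> \<Longrightarrow> \<psi> (b @ [\<sigma>]) = d @ [\<sigma>]"
    "\<And>\<sigma>. \<sigma> \<in> \<Sigma> \<Longrightarrow> ?\<gamma> \<sigma> \<notin> (\<lambda>\<sigma>. b @ [\<sigma>]) ` \<Sigma> \<Longrightarrow> \<psi> (?\<gamma> \<sigma>) = e @ [\<sigma>]"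
  proof (rule bij_betw_extend_two_families[OF fin card _ sub(1) \<gamma>inj \<gamma>B _ sub(2) _ sub(3)])
    show "(\<lambda>\<sigma>. d @ [\<sigma>]) ` \<Sigma> \<inter> (\<lambda>\<sigma>. e @ [\<sigma>]) ` \<Sigma> = {}" using de(2) by auto
  qed (auto simp: inj_on_def)
  have "\<psi> x = e @ [\<sigma>]" if "x \<in> ?B" "\<sigma> \<in> \<Sigma>" "\<phi> x = c @ [\<sigma>]" "x \<notin> caret b" for x \<sigma>
  proof -
    have "?\<gamma> \<sigma> = x" using that \<phi> by (metis bij_betw_inv_into_left)
    then show ?thesis using \<psi>(3)[OF that(2)] that(4) by (simp add: caret_def)
  qed
  then show ?thesis using that \<psi> by blast
qed

lemma three_carets:
  assumes "4 \<le> k"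
  obtains d1 d2 d3 D1 D2 D3 where "forest k D1" "d1 \<in> D1" "forest k D2" "d2 \<in> D2" "forest k D3" "d3 \<in> D3"
    "expand d1 D1 = expand d2 D2" "expand d1 D1 = expand d3 D3" "d1 \<noteq> d2" "d1 \<noteq> d3" "d2 \<noteq> d3"
proof -
  \<comment> \<open>Three expansions on top of \<open>j = k - 2\<close> make \<open>k + 1\<close> in
    all, and \<open>j \<ge> 2\<close> guarantees three leaves to expand.\<close>
  obtain j where j: "k = Suc (Suc j)" "2 \<le> j"
    using assms by (metis add_2_eq_Suc le_Suc_ex numeral_Bit0 add.assoc le_add1)
  obtain D where D: "forest j D" using forest_ex by blast
  have "3 \<le> card D" using card_forest_ge[OF D] j by simp
  then obtain T where "T \<subseteq> D" "card T = 3" by (metis obtain_subset_with_card_n)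
  then obtain a b c where abc: "a \<in> D" "b \<in> D" "c \<in> D" "a \<noteq> b" "a \<noteq> c" "b \<noteq> c"
    by (auto simp: card_3_iff)
  note aD = forest_antichain[OF D]
  have step: "forest k (expand x (expand y D)) \<and> z \<in> expand x (expand y D)"
    if "x \<in> D" "y \<in> D" "z \<in> D" "x \<noteq> y" "x \<noteq> z" "y \<noteq> z" for x y z
  proof -
    have "x \<in> expand y D" "z \<in> expand x (expand y D)" using that by (auto simp: expand_def)
    then show ?thesis using D that(2) j(1) by (auto intro: forest_Suc)
  qed
  \<comment> \<open>Expansions at distinct leaves commute, so each of the three can be regarded as
    the last one.\<close>
  have 1: "expand a (expand b (expand c D)) = expand b (expand a (expand c D))"
    using abc antichain_expand[OF aD] by (intro expand_commute) (auto simp: expand_def)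
  have "expand b (expand a (expand c D)) = expand b (expand c (expand a D))"
    using expand_commute[OF aD, of a c] abc by simp
  also have 2: "\<dots> = expand c (expand b (expand a D))"
    using abc antichain_expand[OF aD] by (intro expand_commute) (auto simp: expand_def)
  finally have "expand a (expand b (expand c D)) = expand c (expand b (expand a D))" using 1 by simp
  then show ?thesis
    using that[of "expand b (expand c D)" a "expand a (expand c D)" b "expand b (expand a D)" c]
      step abc 1 by simp
qed

text \<open>If \<open>\<phi>\<close> does not map any leaf of the caret of \<open>b\<close> into the caret of \<open>c\<close>, one intermediate
  antichain with two carets suffices: both factors carry a caret to a caret.\<close>

lemma pex_disjoint_carets:
  assumes G: "exchanges k \<subseteq> H" "\<forall>f \<in> H. \<forall>g \<in> H. f \<otimes>\<^bsub>HT\<^esub> g \<in> H"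
    and B: "forest k B" "b \<in> B" and C: "forest k C" "c \<in> C"
    and \<phi>: "bij_betw \<phi> (expand b B) (expand c C)"
    and D: "forest k D" "d \<in> D" and E: "forest k E" "e \<in> E" and de: "expand d D = expand e E" "d \<noteq> e"
    and disj: "\<phi> ` caret b \<inter> caret c = {}"
  shows "pex (expand b B) \<phi> \<in> H"
proof -
  let ?B = "expand b B" and ?D = "expand d D"
  obtain \<psi> where \<psi>: "bij_betw \<psi> ?B ?D" "\<And>\<sigma>. \<sigma> \<in> \<Sigma> \<Longrightarrow> \<psi> (b @ [\<sigma>]) = d @ [\<sigma>]"
    "\<And>x \<sigma>. x \<in> ?B \<Longrightarrow> \<sigma> \<in> \<Sigma> \<Longrightarrow> \<phi> x = c @ [\<sigma>] \<Longrightarrow> x \<notin> caret b \<Longrightarrow> \<psi> x = e @ [\<sigma>]"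
    using caret_transport[OF B C \<phi> D E de] by blast
  let ?\<theta> = "\<phi> \<circ> inv_into ?B \<psi>"
  have \<theta>: "bij_betw ?\<theta> (expand e E) (expand c C)"
    unfolding de(1)[symmetric] using bij_betw_trans[OF bij_betw_inv_into[OF \<psi>(1)] \<phi>] .
  have "?\<theta> (e @ [\<sigma>]) = c @ [\<sigma>]" if \<sigma>: "\<sigma> \<in> \<Sigma>" for \<sigma>
  proof -
    have "c @ [\<sigma>] \<in> expand c C" using \<sigma> by (auto simp: expand_def caret_def)
    then obtain x where x: "x \<in> ?B" "\<phi> x = c @ [\<sigma>]" using \<phi> by (metis bij_betw_imp_surj_on imageE)
    then have "x \<notin> caret b" using disj \<sigma> by (auto simp: caret_def)
    then have "\<psi> x = e @ [\<sigma>]" using \<psi>(3) x \<sigma> by blast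
    then show ?thesis using x bij_betw_inv_into_left[OF \<psi>(1) x(1)] by simp
  qed
  then have "pex (expand e E) ?\<theta> \<in> H" using pex_reduce[OF E C \<theta>] G(1) by blast
  moreover have "pex ?B \<psi> \<in> H" using pex_reduce[OF B D \<psi>(1,2)] G(1) by blast
  moreover have "pex ?B \<phi> = pex ?B \<psi> \<otimes>\<^bsub>HT\<^esub> pex ?D ?\<theta>"
    using pex_factor \<psi>(1) B D forest_antichain antichain_expand by metis
  ultimately show ?thesis using G(2) de(1) by simp
qed

text \<open>The first factor moves all leaves that \<open>\<phi>\<close> sends into the caret of
  \<open>c\<close>, if they lie in the caret of \<open>b\<close>, to the caret of \<open>d1\<close>,
  and otherwise to that of \<open>d3\<close>. The caret of \<open>d2\<close> is free of them, so the
  case of disjoint carets applies to the second factor, again with \<open>d1\<close> and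
  \<open>d3\<close> as intermediate carets. This gives three factors in all.\<close>

lemma exchanges_Suc:
  assumes k: "4 \<le> k" and G: "exchanges k \<subseteq> H" "\<forall>f \<in> H. \<forall>g \<in> H. f \<otimes>\<^bsub>HT\<^esub> g \<in> H"
  shows "exchanges (Suc k) \<subseteq> H"
proof
  fix f assume "f \<in> exchanges (Suc k)"
  then obtain B0 C0 \<phi> where f: "f = pex B0 \<phi>" "forest (Suc k) B0" "forest (Suc k) C0" "bij_betw \<phi> B0 C0"
    unfolding exchanges_def by blast
  obtain B b where B: "forest k B" "b \<in> B" "B0 = expand b B" using f(2) by (auto elim: forest.cases)
  obtain C c where C: "forest k C" "c \<in> C" "C0 = expand c C" using f(3) by (auto elim: forest.cases)
  have \<phi>: "bij_betw \<phi> (expand b B) (expand c C)" using f B C by simp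
  obtain d1 d2 d3 D1 D2 D3 where D1: "forest k D1" "d1 \<in> D1" and D2: "forest k D2" "d2 \<in> D2"
    and D3: "forest k D3" "d3 \<in> D3" and D12: "expand d1 D1 = expand d2 D2" 
    and D13: "expand d1 D1 = expand d3 D3" and ne: "d1 \<noteq> d2" "d1 \<noteq> d3" "d2 \<noteq> d3"
    by (rule three_carets[OF k])
  let ?B = "expand b B" and ?D = "expand d1 D1"
  obtain \<psi> where \<psi>: "bij_betw \<psi> ?B ?D" "\<And>\<sigma>. \<sigma> \<in> \<Sigma> \<Longrightarrow> \<psi> (b @ [\<sigma>]) = d1 @ [\<sigma>]"
    "\<And>x \<sigma>. x \<in> ?B \<Longrightarrow> \<sigma> \<in> \<Sigma> \<Longrightarrow> \<phi> x = c @ [\<sigma>] \<Longrightarrow> x \<notin> caret b \<Longrightarrow> \<psi> x = d3 @ [\<sigma>]"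
    using caret_transport[OF B(1,2) C(1,2) \<phi> D1 D3 D13 ne(2)] by blast
  let ?\<theta> = "\<phi> \<circ> inv_into ?B \<psi>"
  have \<theta>: "bij_betw ?\<theta> (expand d2 D2) (expand c C)"
    unfolding D12[symmetric] using bij_betw_trans[OF bij_betw_inv_into[OF \<psi>(1)] \<phi>] .
  have "?\<theta> y \<notin> caret c" if y: "y \<in> caret d2" for y
  proof
    assume "?\<theta> y \<in> caret c"
    then obtain \<sigma> where \<sigma>: "\<sigma> \<in> \<Sigma>" "?\<theta> y = c @ [\<sigma>]" by (auto simp: caret_def)
    have "y \<in> ?D" using y unfolding D12 by (simp add: expand_def)
    then obtain x where x: "x \<in> ?B" "\<psi> x = y" using \<psi>(1) by (metis bij_betw_imp_surj_on imageE)
    then have \<phi>x: "\<phi> x = c @ [\<sigma>]" using \<sigma> bij_betw_inv_into_left[OF \<psi>(1) x(1)] by simp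
    have "y \<in> caret d1 \<or> y \<in> caret d3"
    proof (cases "x \<in> caret b")
      case True
      then show ?thesis using \<psi>(2) x by (auto simp: caret_def)
    next
      case False
      then show ?thesis using \<psi>(3)[OF x(1) \<sigma>(1) \<phi>x] x \<sigma> by (auto simp: caret_def)
    qed
    then show False using y carets_disjoint ne by blast
  qed
  then have "?\<theta> ` caret d2 \<inter> caret c = {}" by blast
  then have "pex (expand d2 D2) ?\<theta> \<in> H"
    by (rule pex_disjoint_carets[OF G D2 C(1,2) \<theta> D1 D3 D13 ne(2)])
  moreover have "pex ?B \<psi> \<in> H" using pex_reduce[OF B(1,2) D1 \<psi>(1,2)] G(1) by blast
  moreover have "pex ?B \<phi> = pex ?B \<psi> \<otimes>\<^bsub>HT\<^esub> pex ?D ?\<theta>"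
    using pex_factor \<psi>(1) B D1 forest_antichain antichain_expand by metis
  ultimately show "f \<in> H" using G(2) D12 f(1) B(3) by simp
qed

lemma finitely_generated_HT:
  obtains A where "finite A" "A \<subseteq> carrier HT" "\<forall>a \<in> A. inv\<^bsub>HT\<^esub> a \<in> A" "generate HT A = carrier HT"
proof -
  interpret HT: group HT by (rule group_HT)
  \<comment> \<open>\<open>exchanges_Suc\<close> starts at \<open>k = 4\<close>, so all exchanges
    with up to four expansions are taken as generators, and their inverses are adjoined.\<close>
  let ?X = "\<Union>k \<le> 4. exchanges k"
  let ?A = "?X \<union> (\<lambda>a. inv\<^bsub>HT\<^esub> a) ` ?X"
  have X: "?X \<subseteq> carrier HT" using carrier_HT_exchanges by auto
  then have A: "?A \<subseteq> carrier HT" by auto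
  have "exchanges k \<subseteq> generate HT ?A" for k
  proof (induction k)
    case 0
    have "exchanges 0 \<subseteq> ?A" by blast
    then show ?case using generate.incl[of _ ?A HT] by blast
  next
    case (Suc k)
    show ?case
    proof (cases "4 \<le> k")
      case True
      have "\<forall>f \<in> generate HT ?A. \<forall>g \<in> generate HT ?A. f \<otimes>\<^bsub>HT\<^esub> g \<in> generate HT ?A"
        using generate.eng by metis
      then show ?thesis by (rule exchanges_Suc[OF True Suc])
    next
      case False
      then have "exchanges (Suc k) \<subseteq> ?A" by auto
      then show ?thesis using generate.incl[of _ ?A HT] by blast
    qed
  qed
  then have "carrier HT \<subseteq> generate HT ?A" unfolding carrier_HT_exchanges by blast
  moreover have "generate HT ?A \<subseteq> carrier HT" using HT.generate_in_carrier[OF A] by blast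
  ultimately have "generate HT ?A = carrier HT" by blast
  moreover have "finite ?A" using finite_exchanges by auto
  moreover have "\<forall>a \<in> ?A. inv\<^bsub>HT\<^esub> a \<in> ?A"
  proof
    fix a assume a: "a \<in> ?A"
    show "inv\<^bsub>HT\<^esub> a \<in> ?A"
    proof (cases "a \<in> ?X")
      case False
      then obtain b where b: "b \<in> ?X" "a = inv\<^bsub>HT\<^esub> b" using a by blast
      then have "inv\<^bsub>HT\<^esub> a = b" using X HT.inv_inv by blast
      then show ?thesis using b by blast
    qed blast
  qed
  ultimately show ?thesis by (intro that[OF _ A])
qed

end

section \<open>Runs of deterministic machines\<close>

lemma run_trans: "run M C u D \<Longrightarrow> run M D v E \<Longrightarrow> run M C (u @ v) E"
  by (induction rule: run.induct) (auto intro: run.intros)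

lemma run_None: "step M C None D \<Longrightarrow> run M C [] D"
  by (auto intro: run.intros)

lemma run_Some: "step M C (Some a) D \<Longrightarrow> run M C [a] D"
  by (auto intro: run.intros)

lemma run_eps: "run M C w D \<Longrightarrow> run M D [] E \<Longrightarrow> run M C w E"
  using run_trans by fastforce

lemma step_deterministic:
  assumes "deterministic M" "step M C l D" "step M C l' D'" "l = l' \<or> l = None \<or> l' = None"
  shows "l = l' \<and> D = D'"
  using assms(2)
proof cases
  case 1: (1 q cs ps act q' ps')
  from assms(3) show ?thesis
  proof cases
    case 2: (1 r ds rs act' r' rs')
    have eq: "r = q" "ds = cs" "rs = ps" using 1(1) 2(1) by auto
    have "l = l' \<and> act = act' \<and> q' = r'"
      using assms(1,4) 1(3) 2(3)[unfolded eq] unfolding deterministic_def by blast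
    then show ?thesis using 1 2 eq by auto
  qed
qed

lemma reading_no_None_step: "reading_config M C \<Longrightarrow> \<not> step M C None D"
proof
  assume r: "reading_config M C" and "step M C None D"
  from this(2) show False
  proof cases
    case (1 q cs ps act q' ps')
    then have "(fst C, None, check_at cs (length ps), top_of ps, act, q') \<in> trans M" by simp
    then show False using r unfolding reading_config_def reading_state_def by blast
  qed
qed

text \<open>The run to \<open>E\<close> passes through \<open>D\<close>. For this \<open>E\<close>
  has to be a reading configuration: with \<open>v\<close> empty, a run could otherwise stop before
  the silent moves that lead to \<open>D\<close>.\<close>

lemma run_deterministic:
  assumes det: "deterministic M"
  shows "run M C u D \<Longrightarrow> run M C (u @ v) E \<Longrightarrow> reading_config M E \<Longrightarrow> run M D v E"
proof (induction rule: run.induct)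
  case (2 C C' w D)
  from 2(4) show ?case
  proof cases
    case 1
    then show ?thesis using 2(1,5) reading_no_None_step by blast
  next
    case (2 C2)
    then have "C2 = C'" using step_deterministic[OF det \<open>step M C None C'\<close>] by blast
    then show ?thesis using 2 "2.IH" "2.prems" by blast
  next
    case (3 a C2)
    then show ?thesis using step_deterministic[OF det \<open>step M C None C'\<close>] by blast
  qed
next
  case (3 C a C' w D)
  from 3(4) show ?case
  proof cases
    case (2 C2)
    then show ?thesis using step_deterministic[OF det \<open>step M C (Some a) C'\<close>] by blast
  next
    case (3 b C2 w')
    then have "b = a" "w' = w @ v" by simp_all
    then have "step M C (Some a) C2" using 3 by simp
    then have "C' = C2" using step_deterministic[OF det \<open>step M C (Some a) C'\<close>] by blast
    then show ?thesis using \<open>run M C2 w' E\<close> \<open>w' = w @ v\<close> "3.IH" "3.prems"(2) by simp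
  qed simp
qed simp

lemma run_deterministic_end:
  assumes "deterministic M" "run M C w D" "run M C w E" "reading_config M D" "reading_config M E"
  shows "D = E"
proof -
  have "run M D [] E" using run_deterministic[OF assms(1,2), of "[]"] assms by simp
  then show ?thesis using reading_no_None_step[OF assms(4)] by cases auto
qed

section \<open>The special cspda\<close>

text \<open>\<open>Init0\<close> to \<open>Init2\<close> build the check stack and
  \<open>Ready\<close> precedes the first transition of the second stage. \<open>Entry\<close> and
  \<open>Moved\<close> await input when the current string equals, respectively differs from, the
  guess. \<open>Remove a p\<close> remembers the letters \<open>p\<close> popped so far,
  \<open>Write r\<close> the letters still to be pushed, the last one first.\<close>

datatype ('a, 'x) machine_state =
  Init0 | Init1 | Init2 | Ready | Entry | Moved | Climb 'a | Look 'a | Copy 'a 'x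
  | Remove 'a "'x list" | Write "'x list" | Unwind

text \<open>\<open>L\<close> is one length at which all generators rewrite, and \<open>rw\<close> is
  the resulting finite table. The bound \<open>K\<close> on its entries keeps the states
  \<open>Write r\<close> finite in number.\<close>

locale ht_machine = ht Q \<Sigma> for Q \<Sigma> :: "'x set" +
  fixes A :: "('x stream \<Rightarrow> 'x stream) set" and L K :: nat
    and rw :: "('x stream \<Rightarrow> 'x stream) \<Rightarrow> 'x list \<Rightarrow> 'x list"
  assumes finite_A: "finite A" and A_carrier: "A \<subseteq> carrier HT" and L_pos: "1 \<le> L"
    and rw_W: "a \<in> A \<Longrightarrow> p \<in> level L \<Longrightarrow> rw a p \<in> W"
    and rw_length: "a \<in> A \<Longrightarrow> p \<in> level L \<Longrightarrow> length (rw a p) \<le> K"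
    and rw: "a \<in> A \<Longrightarrow> p \<in> level L \<Longrightarrow> \<tau> \<in> streams \<Sigma> \<Longrightarrow> a (p @- \<tau>) = rw a p @- \<tau>"
begin

section \<open>Alphabets, transitions and states\<close>

abbreviation "X \<equiv> Q \<union> \<Sigma>"

definition letter_code :: "'x \<Rightarrow> nat" where
  "letter_code = to_nat_on X"

definition cS :: "'x \<Rightarrow> ('x stream \<Rightarrow> 'x stream) stack_symbol" where
  "cS x = Aux (letter_code x)"

text \<open>The parity carries the flag. The same number may code a letter on either stack;
  transitions take the two symbols as separate arguments, so they are not confused.\<close>

definition pS :: "'x \<Rightarrow> bool \<Rightarrow> ('x stream \<Rightarrow> 'x stream) stack_symbol" where
  "pS x b = Aux (2 * letter_code x + of_bool b)"

definition \<Delta> :: "('x stream \<Rightarrow> 'x stream) stack_symbol set" where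
  "\<Delta> = {Bottom, Padding, Top} \<union> cS ` X \<union> Letter ` A"

definition \<Gamma> :: "('x stream \<Rightarrow> 'x stream) stack_symbol set" where
  "\<Gamma> = {Bottom, Padding} \<union> (\<lambda>(x, b). pS x b) ` (X \<times> UNIV) \<union> Letter ` A"

text \<open>Agreement up to and including the current height: the visible symbols agree and the flag
  vouches for everything below. It is evaluated before a push and becomes the flag of the pushed
  letter, since the check symbol facing that letter is not yet visible.\<close>

definition matched where
  "matched d g \<longleftrightarrow> d = Bottom \<and> g = Bottom \<or> (\<exists>x \<in> X. d = cS x \<and> g = pS x True)"

text \<open>The symbol at height \<open>h + 1\<close> of the check stack is visible only from that height, so
  copying it onto the pushdown stack takes three moves: \<open>climb\<close> pushes a padding symbol, \<open>look\<close>
  remembers the check symbol and pops, and \<open>copy\<close> pushes the letter.\<close>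

inductive move where
  enter: "move Ready None None None (Push Bottom) Entry"
| read_entry: "a \<in> A \<Longrightarrow> move Entry (Some a) (Some Bottom) (Some Bottom) Stay (Climb a)"
| read_moved: "a \<in> A \<Longrightarrow> d \<in> \<Delta> \<Longrightarrow> g \<in> \<Gamma> \<Longrightarrow>
    move Moved (Some a) (Some d) (Some g) Stay (Remove a [])"
| climb: "a \<in> A \<Longrightarrow> d \<in> \<Delta> \<Longrightarrow> d \<noteq> Top \<Longrightarrow> g \<in> \<Gamma> \<Longrightarrow>
    move (Climb a) None (Some d) (Some g) (Push Padding) (Look a)"
| look: "a \<in> A \<Longrightarrow> x \<in> X \<Longrightarrow> move (Look a) None (Some (cS x)) (Some Padding) Pop (Copy a x)"
| copy: "a \<in> A \<Longrightarrow> x \<in> X \<Longrightarrow> d \<in> \<Delta> \<Longrightarrow> d \<noteq> Top \<Longrightarrow> g \<in> \<Gamma> \<Longrightarrow>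
    move (Copy a x) None (Some d) (Some g) (Push (pS x True))
      (if x \<in> Q then Remove a [] else Climb a)"
| remove: "a \<in> A \<Longrightarrow> x \<in> X \<Longrightarrow> p @ [x] \<in> W \<Longrightarrow> length p < L \<Longrightarrow> d \<in> \<Delta> \<Longrightarrow>
    move (Remove a p) None (Some d) (Some (pS x b)) Pop
      (if Suc (length p) = L then Write (rw a (p @ [x])) else Remove a (p @ [x]))"
| push: "x \<in> X \<Longrightarrow> r \<in> lists X \<Longrightarrow> length r < K \<Longrightarrow> d \<in> \<Delta> \<Longrightarrow> d \<noteq> Top \<Longrightarrow> g \<in> \<Gamma> \<Longrightarrow>
    move (Write (r @ [x])) None (Some d) (Some g) (Push (pS x (matched d g))) (Write r)"
| finish: "d \<in> \<Delta> \<Longrightarrow> g \<in> \<Gamma> \<Longrightarrow>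
    move (Write []) None (Some d) (Some g) Stay (if matched d g then Unwind else Moved)"
| unwind: "x \<in> X \<Longrightarrow> d \<in> \<Delta> \<Longrightarrow> move Unwind None (Some d) (Some (pS x b)) Pop Unwind"
| home: "d \<in> \<Delta> \<Longrightarrow> move Unwind None (Some d) (Some Bottom) Stay Entry"

text \<open>A state without any transition would count as reading, hence would have to be accepting
  by P7. So \<open>S\<close> contains only states that have a transition; this is why
  \<open>p\<close> in \<open>Remove a p\<close> is empty or in \<open>W\<close> and shorter than
  \<open>L\<close>.\<close>

definition S :: "('x stream \<Rightarrow> 'x stream, 'x) machine_state set" where
  "S = {Init0, Init1, Init2, Ready, Entry, Moved, Unwind} \<union> Climb ` A \<union> Look ` A \<union>
     (\<lambda>(a, x). Copy a x) ` (A \<times> X) \<union>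
     (\<lambda>(a, p). Remove a p) ` (A \<times> {p \<in> insert [] W. length p < L}) \<union>
     Write ` {r \<in> lists X. length r \<le> K}"

definition enc :: "('x stream \<Rightarrow> 'x stream, 'x) machine_state \<Rightarrow> nat" where
  "enc = to_nat_on S"

text \<open>The first stage produces \<open>Bottom\<close>, letters of \<open>\<Sigma>\<close>, one
  letter of \<open>Q\<close>, padding and \<open>Top\<close>: a string of \<open>W\<close> written
  backwards, with free space above it.\<close>

definition M :: "(nat, 'x stream \<Rightarrow> 'x stream, ('x stream \<Rightarrow> 'x stream) stack_symbol) cspda" where
  "M = \<lparr>states = enc ` S, input = A, check_alphabet = \<Delta>, pushdown_alphabet = \<Gamma>,
     start = enc Init0, accepting = {enc Moved},
     init_trans = {(enc Init0, Bottom, enc Init1), (enc Init2, Padding, enc Init2),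
         (enc Init2, Top, enc Ready)} \<union>
       {(enc Init1, cS \<sigma>, enc Init1) | \<sigma>. \<sigma> \<in> \<Sigma>} \<union> {(enc Init1, cS q, enc Init2) | q. q \<in> Q},
     trans = {(enc s, l, d, g, act, enc s') | s l d g act s'. move s l d g act s'}\<rparr>"

section \<open>Codes, determinism and reading states\<close>

lemma M_simps [simp]:
  "states M = enc ` S" "input M = A" "check_alphabet M = \<Delta>" "pushdown_alphabet M = \<Gamma>"
  "start M = enc Init0" "accepting M = {enc Moved}"
  "trans M = {(enc s, l, d, g, act, enc s') | s l d g act s'. move s l d g act s'}"
  by (simp_all add: M_def)

lemma W_lists: "W \<subseteq> lists X"
  by (auto simp: fin_strings_def)

lemma letter_code_eq: "x \<in> X \<Longrightarrow> y \<in> X \<Longrightarrow> letter_code x = letter_code y \<longleftrightarrow> x = y"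
  unfolding letter_code_def using finite_Q finite_Sigma
  by (intro to_nat_on_inj) (auto intro: countable_finite)

lemma cS_eq [simp]: "x \<in> X \<Longrightarrow> y \<in> X \<Longrightarrow> cS x = cS y \<longleftrightarrow> x = y"
  unfolding cS_def using letter_code_eq by simp

lemma pS_eq [simp]: "x \<in> X \<Longrightarrow> y \<in> X \<Longrightarrow> pS x b = pS y b' \<longleftrightarrow> x = y \<and> b = b'"
proof -
  assume "x \<in> X" "y \<in> X"
  moreover have "2 * m + of_bool b = 2 * n + of_bool b' \<longleftrightarrow> m = n \<and> b = b'" for m n :: nat
    by (cases b; cases b'; simp; presburger)
  ultimately show ?thesis unfolding pS_def using letter_code_eq by simp
qed

lemma symbols_distinct [simp]:
  "cS x \<noteq> Bottom" "cS x \<noteq> Top" "cS x \<noteq> Padding" "Bottom \<noteq> cS x" "Top \<noteq> cS x" "Padding \<noteq> cS x"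
  "pS x b \<noteq> Bottom" "pS x b \<noteq> Top" "pS x b \<noteq> Padding"
  "Bottom \<noteq> pS x b" "Top \<noteq> pS x b" "Padding \<noteq> pS x b"
  by (simp_all add: cS_def pS_def)

lemma symbols_in [simp]:
  "Bottom \<in> \<Delta>" "Padding \<in> \<Delta>" "Top \<in> \<Delta>" "x \<in> X \<Longrightarrow> cS x \<in> \<Delta>"
  "Bottom \<in> \<Gamma>" "Padding \<in> \<Gamma>" "x \<in> X \<Longrightarrow> pS x b \<in> \<Gamma>"
  by (auto simp: \<Delta>_def \<Gamma>_def)

lemma S_simps [simp]:
  "Init0 \<in> S" "Init1 \<in> S" "Init2 \<in> S" "Ready \<in> S" "Entry \<in> S" "Moved \<in> S" "Unwind \<in> S"
  "Climb a \<in> S \<longleftrightarrow> a \<in> A" "Look a \<in> S \<longleftrightarrow> a \<in> A" "Copy a x \<in> S \<longleftrightarrow> a \<in> A \<and> x \<in> X"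
  "Remove a p \<in> S \<longleftrightarrow> a \<in> A \<and> p \<in> insert [] W \<and> length p < L"
  "Write r \<in> S \<longleftrightarrow> r \<in> lists X \<and> length r \<le> K"
  by (auto simp: S_def)

lemma finite_S: "finite S"
proof -
  have fX: "finite X" using finite_Q finite_Sigma by simp
  have "finite {p. set p \<subseteq> X \<and> length p \<le> n}" for n
    by (rule finite_lists_length_le[OF fX])
  moreover have "{p \<in> insert [] W. length p < L} \<subseteq> {p. set p \<subseteq> X \<and> length p \<le> L}"
    using W_lists by auto
  moreover have "{r \<in> lists X. length r \<le> K} \<subseteq> {p. set p \<subseteq> X \<and> length p \<le> K}" by auto
  ultimately have "finite {p \<in> insert [] W. length p < L}" "finite {r \<in> lists X. length r \<le> K}"
    using finite_subset by blast+
  then show ?thesis unfolding S_def using finite_A fX by simp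
qed

lemma enc_eq [simp]: "s \<in> S \<Longrightarrow> s' \<in> S \<Longrightarrow> enc s = enc s' \<longleftrightarrow> s = s'"
  unfolding enc_def using finite_S by (intro to_nat_on_inj) (auto intro: countable_finite)

lemma prefix_level: "p @ [x] \<in> W \<Longrightarrow> Suc (length p) = L \<Longrightarrow> p @ [x] \<in> level L"
  by (simp add: level_def)

lemma move_closed:
  assumes "move s l d g act s'"
  shows "s \<in> S \<and> s' \<in> S \<and> set_option l \<subseteq> A \<and> set_option d \<subseteq> \<Delta> \<and> set_option g \<subseteq> \<Gamma> \<and>
    set_action act \<subseteq> \<Gamma>"
  using assms
proof cases
  case (remove a x p d b)
  have rw: "rw a (p @ [x]) \<in> lists X \<and> length (rw a (p @ [x])) \<le> K" if "Suc (length p) = L"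
    using prefix_level[OF remove(9) that] rw_W rw_length remove W_lists by blast
  have p: "p \<in> insert [] W" using remove(9) append_in_W by blast
  show ?thesis using remove p rw by auto
qed (use L_pos in auto)

lemma trans_M_iff:
  "(q, l, d, g, act, q') \<in> trans M \<longleftrightarrow> (\<exists>s s'. q = enc s \<and> q' = enc s' \<and> move s l d g act s')"
  by simp

lemma trans_M_enc:
  assumes "s \<in> S"
  shows "(enc s, l, d, g, act, q') \<in> trans M \<longleftrightarrow> (\<exists>s'. q' = enc s' \<and> move s l d g act s')"
  unfolding trans_M_iff using assms move_closed enc_eq by metis

lemma move_deterministic:
  assumes "move s l d g act s1" "move s l' d g act' s2" "l = l' \<or> l = None \<or> l' = None"
  shows "l = l' \<and> act = act' \<and> s1 = s2"
  using assms by (elim move.cases; auto)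

lemma deterministic_M: "deterministic M"
  unfolding deterministic_def
proof (intro allI impI)
  fix q l l' d g act act' q1 q2
  assume "(q, l, d, g, act, q1) \<in> trans M \<and> (q, l', d, g, act', q2) \<in> trans M \<and>
    (l = l' \<or> l = None \<or> l' = None)"
  then have t: "(q, l, d, g, act, q1) \<in> trans M" "(q, l', d, g, act', q2) \<in> trans M"
    and l: "l = l' \<or> l = None \<or> l' = None" by blast+
  obtain s s1 where s: "q = enc s" "q1 = enc s1" "move s l d g act s1"
    using t(1) unfolding trans_M_iff by blast
  then have "s \<in> S" using move_closed by blast
  then obtain s2 where "q2 = enc s2" "move s l' d g act' s2"
    using t(2) unfolding s(1) trans_M_enc[OF \<open>s \<in> S\<close>] by blast
  then show "l = l' \<and> act = act' \<and> q1 = q2" using move_deterministic s l by blast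
qed

lemma step_M_iff:
  assumes "s \<in> S"
  shows "step M (enc s, cs, ps) l D \<longleftrightarrow>
    (\<exists>act s' ps'. move s l (check_at cs (length ps)) (top_of ps) act s' \<and>
      apply_action act ps = Some ps' \<and> D = (enc s', cs, ps'))"
proof
  assume "step M (enc s, cs, ps) l D"
  then show "\<exists>act s' ps'. move s l (check_at cs (length ps)) (top_of ps) act s' \<and>
      apply_action act ps = Some ps' \<and> D = (enc s', cs, ps')"
  proof cases
    case (1 act q' ps')
    then show ?thesis unfolding trans_M_enc[OF assms] by blast
  qed
next
  assume "\<exists>act s' ps'. move s l (check_at cs (length ps)) (top_of ps) act s' \<and>
      apply_action act ps = Some ps' \<and> D = (enc s', cs, ps')"
  then obtain act s' ps' where *: "move s l (check_at cs (length ps)) (top_of ps) act s'"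
    "apply_action act ps = Some ps'" "D = (enc s', cs, ps')" by blast
  then have "(enc s, l, check_at cs (length ps), top_of ps, act, enc s') \<in> trans M"
    unfolding trans_M_iff by blast
  then show "step M (enc s, cs, ps) l D" unfolding *(3) using *(2) by (rule step.intros)
qed

lemma move_step:
  assumes "move s l d g act s'" "check_at cs (length ps) = d" "top_of ps = g"
    "apply_action act ps = Some ps'"
  shows "step M (enc s, cs, ps) l (enc s', cs, ps')"
  using assms step_M_iff move_closed by blast

lemma step_M_state: "step M C l D \<Longrightarrow> \<exists>s \<in> S. fst C = enc s"
proof (elim step.cases)
  fix q l' cs ps act q' ps'
  assume "C = (q, cs, ps)" "(q, l', check_at cs (length ps), top_of ps, act, q') \<in> trans M"
  then show ?thesis unfolding trans_M_iff using move_closed by fastforce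
qed

lemma reading_state_M: "reading_state M q \<longleftrightarrow> q = enc Entry \<or> q = enc Moved"
proof
  assume r: "reading_state M q"
  then obtain s where s: "s \<in> S" "q = enc s" by (auto simp: reading_state_def)
  have no: "\<not> move s None d g act s'" for d g act s'
    using r trans_M_enc[OF s(1)] unfolding reading_state_def s(2) by blast
  have ni: "(enc s, d, q') \<notin> init_trans M" for d q'
    using r s unfolding reading_state_def by auto
  obtain \<sigma> q0 where \<sigma>: "\<sigma> \<in> \<Sigma>" "q0 \<in> Q" using Sigma_nonempty Q_nonempty by blast
  show "q = enc Entry \<or> q = enc Moved"
  proof (cases s)
    case Init0
    then show ?thesis using ni by (auto simp: M_def)
  next
    case Init1
    then show ?thesis using ni \<sigma> by (auto simp: M_def)
  next
    case Init2
    then show ?thesis using ni by (auto simp: M_def)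
  next
    case Ready
    then show ?thesis using no enter by blast
  next
    case (Climb a)
    then show ?thesis using no climb[of a Bottom Bottom] s by auto
  next
    case (Look a)
    then show ?thesis using no look[of a \<sigma>] s \<sigma> by auto
  next
    case (Copy a x)
    then show ?thesis using no copy[of a x Bottom Bottom] s by auto
  next
    case (Remove a p)
    then have p: "p = [] \<or> p \<in> W" using s by auto
    \<comment> \<open>A letter of \<open>Q\<close> continues the empty \<open>p\<close>, a letter of
      \<open>\<Sigma>\<close> any other; the latter relies on \<open>p \<in> W\<close>.\<close>
    have "\<exists>x \<in> X. p @ [x] \<in> W"
    proof (cases "p = []")
      case True
      then show ?thesis using \<sigma> by (auto simp: Cons_in_W)
    next
      case False
      then show ?thesis using p append_in_WI[of p "[\<sigma>]"] \<sigma> by auto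
    qed
    then show ?thesis using no remove[of a _ p Bottom] s Remove by fastforce
  next
    case (Write r)
    show ?thesis
    proof (cases r rule: rev_cases)
      case Nil
      then show ?thesis using no finish[of Bottom Bottom] Write by auto
    next
      case (snoc r' x)
      then show ?thesis using no push[of x r' Bottom Bottom] Write s by auto
    qed
  next
    case Unwind
    then show ?thesis using no home[of Bottom] by auto
  qed (use s in auto)
next
  assume "q = enc Entry \<or> q = enc Moved"
  then obtain s where s: "s = Entry \<or> s = Moved" "s \<in> S" "q = enc s" by auto
  have "l \<noteq> None" if "move s l d g act s'" for l d g act s'
    using that by cases (use s(1) in auto)
  moreover have "(enc s, d, q') \<notin> init_trans M" for d q'
    using s by (auto simp: M_def)
  ultimately show "reading_state M q"
    unfolding reading_state_def s(3) trans_M_enc[OF s(2)] using s(2) by auto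
qed

section \<open>Configurations that represent strings\<close>

definition check_stack :: "'x list \<Rightarrow> nat \<Rightarrow> ('x stream \<Rightarrow> 'x stream) stack_symbol list" where
  "check_stack x k = Bottom # map cS (rev x) @ replicate k Padding @ [Top]"

text \<open>The pushdown stack holding the string \<open>c\<close>, with the first letter on top. The flag of a letter
  records that the letters strictly below it agree with those of \<open>x\<close> on the check stack.\<close>

fun pushdown :: "'x list \<Rightarrow> 'x list \<Rightarrow> ('x stream \<Rightarrow> 'x stream) stack_symbol list" where
  "pushdown x [] = [Bottom]"
| "pushdown x (y # c) = pS y (suffix c x) # pushdown x c"

text \<open>The string \<open>x\<close> itself is represented by the entry configuration only, so that
  the configuration is determined by \<open>x\<close>, \<open>k\<close> and the current string \<open>c\<close>.\<close>

definition config_of :: "'x list \<Rightarrow> nat \<Rightarrow> 'x list \<Rightarrow> (nat, ('x stream \<Rightarrow> 'x stream) stack_symbol) config" where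
  "config_of x k c = (if c = x then (enc Entry, check_stack x k, [Bottom])
     else (enc Moved, check_stack x k, pushdown x c))"

lemma length_pushdown [simp]: "length (pushdown x c) = Suc (length c)"
  by (induction c) auto

lemma top_of_pushdown:
  assumes "c \<in> lists X"
  obtains g where "top_of (pushdown x c) = Some g" "g \<in> \<Gamma>"
  using assms by (cases c) (auto simp: top_of_def)

text \<open>The stack has height \<open>length x + k + 2\<close>, the bottom symbol included.
  Pushing is blocked only by \<open>Top\<close>, so the strings that fit are those of length at most
  \<open>length x + k + 1\<close>; this is the bound in all later lemmas.\<close>

lemma check_at_check_stack:
  assumes "x \<in> lists X" "h \<le> length x + k + 1"
  obtains d where "check_at (check_stack x k) (Suc h) = Some d" "d \<in> \<Delta>"
    "d = Top \<longleftrightarrow> h = length x + k + 1"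
proof -
  have len: "length (check_stack x k) = length x + k + 2" by (simp add: check_stack_def)
  let ?d = "check_stack x k ! h"
  have "check_at (check_stack x k) (Suc h) = Some ?d" using assms(2) len by (simp add: check_at_def)
  moreover have "?d \<in> \<Delta>"
  proof -
    have "set (check_stack x k) \<subseteq> \<Delta>" using assms(1) by (auto simp: check_stack_def)
    then show ?thesis using nth_mem[of h "check_stack x k"] len assms(2) by fastforce
  qed
  moreover have "?d = Top \<longleftrightarrow> h = length x + k + 1"
  proof (cases h)
    case (Suc i)
    then show ?thesis
      using assms(2) by (auto simp: check_stack_def nth_append)
  qed (simp add: check_stack_def)
  ultimately show ?thesis using that by blast
qed

lemma check_at_letter:
  assumes "suffix (y # c) x"
  shows "check_at (check_stack x k) (Suc (Suc (length c))) = Some (cS y)"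
proof -
  obtain z where "x = z @ y # c" using assms by (auto simp: suffix_def)
  then show ?thesis by (simp add: check_at_def check_stack_def nth_append)
qed

text \<open>Both stacks hold strings with the last letter at the bottom, so agreement from the
  bottom up means a common suffix.\<close>

lemma matched_iff_suffix:
  assumes x: "x \<in> lists X" and c: "c \<in> lists X"
    and d: "check_at (check_stack x k) (Suc (length c)) = Some d"
    and g: "top_of (pushdown x c) = Some g"
  shows "matched d g \<longleftrightarrow> suffix c x"
proof (cases c)
  case Nil
  then show ?thesis using d g by (simp add: check_at_def check_stack_def top_of_def matched_def)
next
  case (Cons y c')
  have y: "y \<in> X" using c Cons by auto
  have g: "g = pS y (suffix c' x)" using g Cons by (simp add: top_of_def)
  show ?thesis
  proof
    assume "suffix c x"
    then show "matched d g"
      using check_at_letter[of y c' x k] d g Cons y suffix_ConsD by (auto simp: matched_def)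
  next
    assume m: "matched d g"
    then have d': "d = cS y" and s: "suffix c' x" using g y by (auto simp: matched_def)
    obtain z where z: "x = z @ c'" using s by (auto simp: suffix_def)
    \<comment> \<open>If \<open>c'\<close> were all of \<open>x\<close>, the check symbol above it
      would be \<open>Padding\<close> or \<open>Top\<close>, not a letter.\<close>
    have "z \<noteq> []"
    proof
      assume "z = []"
      then have "d = (replicate k Padding @ [Top]) ! 0"
        using d z Cons by (auto simp: check_at_def check_stack_def nth_append split: if_splits)
      then show False using d' by (cases k) auto
    qed
    then obtain z' y' where z': "z = z' @ [y']" by (cases z rule: rev_cases) auto
    then have "suffix (y' # c') x" using z by (auto simp: suffix_def)
    then have "cS y' = cS y" using check_at_letter d d' Cons by fastforce
    then have "y' = y" using x z z' y by auto
    then show "suffix c x" using \<open>suffix (y' # c') x\<close> Cons by simp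
  qed
qed

text \<open>Only the first letter of an element of \<open>W\<close> lies in \<open>Q\<close>, and a
  proper suffix of \<open>x\<close> consists of letters of \<open>\<Sigma>\<close>.\<close>

lemma suffix_W: "c \<in> W \<Longrightarrow> x \<in> W \<Longrightarrow> suffix c x \<longleftrightarrow> c = x"
proof
  assume c: "c \<in> W" and x: "x \<in> W" and "suffix c x"
  then obtain z where z: "x = z @ c" by (auto simp: suffix_def)
  show "c = x"
  proof (cases "z = []")
    case False
    then have "c \<in> lists \<Sigma>" using x z append_in_W by blast
    then show ?thesis using c disjoint by (auto simp: fin_strings_def)
  qed (use z in simp)
qed simp

section \<open>Runs between reading configurations\<close>

lemma climb_letter:
  assumes a: "a \<in> A" and x: "x \<in> lists X" and y: "suffix (y # c) x"
  shows "run M (enc (Climb a), check_stack x k, pushdown x c) []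
    (enc (if y \<in> Q then Remove a [] else Climb a), check_stack x k, pushdown x (y # c))"
proof -
  obtain z where "x = z @ y # c" using y by (auto simp: suffix_def)
  then have yX: "y \<in> X" and cX: "c \<in> lists X" and len: "length c < length x" using x by auto
  obtain d where d: "check_at (check_stack x k) (Suc (length c)) = Some d" "d \<in> \<Delta>" "d \<noteq> Top"
    using check_at_check_stack[OF x, of "length c" k] len by auto
  obtain g where g: "top_of (pushdown x c) = Some g" "g \<in> \<Gamma>" using top_of_pushdown[OF cX] .
  have "step M (enc (Climb a), check_stack x k, pushdown x c) None
      (enc (Look a), check_stack x k, Padding # pushdown x c)"
    by (rule move_step[OF climb[OF a d(2,3) g(2)]]) (simp_all add: d g)
  moreover have "step M (enc (Look a), check_stack x k, Padding # pushdown x c) None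
      (enc (Copy a y), check_stack x k, pushdown x c)"
    by (rule move_step[OF look[OF a yX]]) (simp_all add: check_at_letter[OF y] top_of_def)
  \<comment> \<open>The flag \<open>True\<close> is right because \<open>c\<close> is a suffix of
    \<open>x\<close>.\<close>
  moreover have "step M (enc (Copy a y), check_stack x k, pushdown x c) None
      (enc (if y \<in> Q then Remove a [] else Climb a), check_stack x k, pushdown x (y # c))"
    by (rule move_step[OF copy[OF a yX d(2,3) g(2)]]) (use d g suffix_ConsD[OF y] in auto)
  ultimately show ?thesis by (blast intro: run.intros)
qed

text \<open>Induction over the suffixes of the tail of \<open>x\<close>: letters of
  \<open>\<Sigma>\<close> keep the machine climbing, and the one letter of \<open>Q\<close>, at the
  upper end, stops it.\<close>

lemma climb_run:
  assumes a: "a \<in> A" and x: "x \<in> W"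
  shows "run M (enc (Climb a), check_stack x k, [Bottom]) []
    (enc (Remove a []), check_stack x k, pushdown x x)"
proof -
  obtain q u where qu: "x = q # u" "q \<in> Q" "u \<in> lists \<Sigma>" using x by (auto simp: fin_strings_def)
  have xX: "x \<in> lists X" using x W_lists by blast
  have "suffix c u \<Longrightarrow> run M (enc (Climb a), check_stack x k, [Bottom]) []
      (enc (Climb a), check_stack x k, pushdown x c)" for c
  proof (induction c)
    case (Cons y c)
    have "y \<in> \<Sigma>" using Cons.prems qu(3) by (auto simp: suffix_def)
    then have "y \<notin> Q" using disjoint by blast
    moreover have "suffix (y # c) x" using Cons.prems qu(1) by (simp add: suffix_Cons)
    ultimately have "run M (enc (Climb a), check_stack x k, pushdown x c) []
      (enc (Climb a), check_stack x k, pushdown x (y # c))"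
      using climb_letter[OF a xX, of y c k] by simp
    then show ?case using run_eps Cons.IH suffix_ConsD[OF Cons.prems] by blast
  qed (auto intro: run.intros)
  then have "run M (enc (Climb a), check_stack x k, [Bottom]) []
      (enc (Climb a), check_stack x k, pushdown x u)" by simp
  moreover have "run M (enc (Climb a), check_stack x k, pushdown x u) []
      (enc (Remove a []), check_stack x k, pushdown x x)"
    using climb_letter[OF a xX, of q u k] qu by simp
  ultimately show ?thesis by (rule run_eps)
qed

lemma remove_letter:
  assumes a: "a \<in> A" and x: "x \<in> lists X" and c: "length (z # c) \<le> length x + k + 1"
    and p: "p @ [z] \<in> W" "length p < L"
  shows "step M (enc (Remove a p), check_stack x k, pushdown x (z # c)) None
    (enc (if Suc (length p) = L then Write (rw a (p @ [z])) else Remove a (p @ [z])),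
      check_stack x k, pushdown x c)"
proof -
  have z: "z \<in> X" using W_lists p(1) by auto
  obtain d where d: "check_at (check_stack x k) (Suc (length (z # c))) = Some d" "d \<in> \<Delta>"
    using check_at_check_stack[OF x c] .
  show ?thesis
    by (rule move_step[OF remove[OF a z p d(2)]]) (use d in \<open>auto simp: top_of_def\<close>)
qed

lemma remove_run:
  assumes a: "a \<in> A" and x: "x \<in> lists X"
  shows "length (p' @ c) \<le> length x + k + 1 \<Longrightarrow> p @ p' \<in> level L \<Longrightarrow> p' \<noteq> [] \<Longrightarrow>
    run M (enc (Remove a p), check_stack x k, pushdown x (p' @ c)) []
      (enc (Write (rw a (p @ p'))), check_stack x k, pushdown x c)"
proof (induction p' arbitrary: p)
  case (Cons z p')
  have W: "(p @ [z]) @ p' \<in> W" and len: "length p + Suc (length p') = L"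
    using Cons.prems by (auto simp: level_def)
  then have pz: "p @ [z] \<in> W" using append_in_W[of "p @ [z]" p'] by simp
  have *: "step M (enc (Remove a p), check_stack x k, pushdown x (z # p' @ c)) None
    (enc (if Suc (length p) = L then Write (rw a (p @ [z])) else Remove a (p @ [z])),
      check_stack x k, pushdown x (p' @ c))"
    using Cons.prems len by (intro remove_letter[OF a x _ pz]) auto
  show ?case
  proof (cases "p' = []")
    case True
    then show ?thesis using * len by (auto dest: run_None)
  next
    case False
    then have "run M (enc (Remove a (p @ [z])), check_stack x k, pushdown x (p' @ c)) []
      (enc (Write (rw a ((p @ [z]) @ p'))), check_stack x k, pushdown x c)"
      using Cons.prems by (intro Cons.IH) auto
    moreover have "Suc (length p) \<noteq> L" using len False by auto
    ultimately show ?thesis using * by (auto intro: run.intros)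
  qed
qed simp

text \<open>Covers a current string with fewer than \<open>L\<close> letters: popping arrives at
  \<open>Bottom\<close> before the table can be consulted, and \<open>Remove\<close> has no move
  there.\<close>

lemma remove_all_run:
  assumes a: "a \<in> A" and x: "x \<in> lists X"
  shows "length c \<le> length x + k + 1 \<Longrightarrow> p @ c \<in> insert [] W \<Longrightarrow> length (p @ c) < L \<Longrightarrow>
    run M (enc (Remove a p), check_stack x k, pushdown x c) []
      (enc (Remove a (p @ c)), check_stack x k, [Bottom])"
proof (induction c arbitrary: p)
  case (Cons z c)
  have "(p @ [z]) @ c \<in> W" using Cons.prems by auto
  then have pz: "p @ [z] \<in> W" using append_in_W[of "p @ [z]" c] by simp
  have "step M (enc (Remove a p), check_stack x k, pushdown x (z # c)) None
    (enc (if Suc (length p) = L then Write (rw a (p @ [z])) else Remove a (p @ [z])),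
      check_stack x k, pushdown x c)"
    using Cons.prems by (intro remove_letter[OF a x _ pz]) auto
  moreover have "run M (enc (Remove a (p @ [z])), check_stack x k, pushdown x c) []
      (enc (Remove a ((p @ [z]) @ c)), check_stack x k, [Bottom])"
    using Cons.prems by (intro Cons.IH) auto
  ultimately show ?case using Cons.prems by (auto intro: run.intros)
qed (auto intro: run.intros)

text \<open>A remaining part \<open>r'\<close> is allowed so that the lemma also describes a write
  that is cut short by \<open>Top\<close>.\<close>

lemma write_run:
  assumes x: "x \<in> lists X"
  shows "c \<in> lists X \<Longrightarrow> r' @ r \<in> lists X \<Longrightarrow> length (r' @ r) \<le> K \<Longrightarrow>
    length (r @ c) \<le> length x + k + 1 \<Longrightarrow>
    run M (enc (Write (r' @ r)), check_stack x k, pushdown x c) []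
      (enc (Write r'), check_stack x k, pushdown x (r @ c))"
proof (induction r arbitrary: c rule: rev_induct)
  case (snoc z r)
  have z: "z \<in> X" and r: "r' @ r \<in> lists X" and K: "length (r' @ r) < K" using snoc.prems by auto
  have "length c < length x + k + 1" using snoc.prems(4) by simp
  then obtain d where d: "check_at (check_stack x k) (Suc (length c)) = Some d" "d \<in> \<Delta>" "d \<noteq> Top"
    using check_at_check_stack[OF x, of "length c" k] by auto
  obtain g where g: "top_of (pushdown x c) = Some g" "g \<in> \<Gamma>" using top_of_pushdown[OF snoc.prems(1)] .
  have "matched d g \<longleftrightarrow> suffix c x" using matched_iff_suffix[OF x snoc.prems(1) d(1) g(1)] .
  then have "step M (enc (Write ((r' @ r) @ [z])), check_stack x k, pushdown x c) None
      (enc (Write (r' @ r)), check_stack x k, pushdown x (z # c))"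
    by (intro move_step[OF push[OF z r K d(2,3) g(2)]]) (simp_all add: d g)
  moreover have "run M (enc (Write (r' @ r)), check_stack x k, pushdown x (z # c)) []
      (enc (Write r'), check_stack x k, pushdown x (r @ z # c))"
    using snoc.prems by (intro snoc.IH) auto
  ultimately show ?case by (auto intro: run.intros)
qed (auto intro: run.intros)

lemma unwind_run:
  assumes x: "x \<in> lists X"
  shows "c \<in> lists X \<Longrightarrow> length c \<le> length x + k + 1 \<Longrightarrow>
    run M (enc Unwind, check_stack x k, pushdown x c) [] (enc Entry, check_stack x k, [Bottom])"
proof (induction c)
  case Nil
  have "step M (enc Unwind, check_stack x k, [Bottom]) None (enc Entry, check_stack x k, [Bottom])"
    by (rule move_step[OF home[of Bottom]]) (auto simp: check_at_def check_stack_def top_of_def)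
  then show ?case by (auto dest: run_None)
next
  case (Cons y c)
  have y: "y \<in> X" using Cons.prems by simp
  obtain d where d: "check_at (check_stack x k) (Suc (length (y # c))) = Some d" "d \<in> \<Delta>"
    using check_at_check_stack[OF x Cons.prems(2)] .
  have "step M (enc Unwind, check_stack x k, pushdown x (y # c)) None
      (enc Unwind, check_stack x k, pushdown x c)"
    by (rule move_step[OF unwind[OF y d(2)]]) (use d in \<open>auto simp: top_of_def\<close>)
  then show ?case using Cons by (auto intro: run.intros)
qed

lemma finish_run:
  assumes x: "x \<in> W" and c: "c \<in> W" "length c \<le> length x + k + 1"
  shows "run M (enc (Write []), check_stack x k, pushdown x c) [] (config_of x k c)"
proof -
  have X: "x \<in> lists X" "c \<in> lists X" using x c W_lists by auto
  obtain d where d: "check_at (check_stack x k) (Suc (length c)) = Some d" "d \<in> \<Delta>"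
    using check_at_check_stack[OF X(1) c(2)] .
  obtain g where g: "top_of (pushdown x c) = Some g" "g \<in> \<Gamma>" using top_of_pushdown[OF X(2)] .
  have m: "matched d g \<longleftrightarrow> c = x"
    using matched_iff_suffix[OF X d(1) g(1)] suffix_W x c by simp
  have "step M (enc (Write []), check_stack x k, pushdown x c) None
      (enc (if matched d g then Unwind else Moved), check_stack x k, pushdown x c)"
    by (rule move_step[OF finish[OF d(2) g(2)]]) (simp_all add: d g)
  then show ?thesis
    using m unwind_run[OF X c(2)] by (auto simp: config_of_def intro: run.intros)
qed

text \<open>No step on any letter is more than \<open>gets_stuck\<close> asks, so such a
  configuration is a witness whatever input remains. Reading configurations are excluded because
  stopping in one at the end of the input is no failure.\<close>

definition stuck where
  "stuck D \<longleftrightarrow> \<not> reading_config M D \<and> (\<forall>l E. \<not> step M D l E)"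

text \<open>The effect of one input letter on the current string, with \<open>N\<close> the greatest
  length that fits. \<open>None\<close> stands for both ways of getting stuck: too few letters to
  rewrite, or too many to store.\<close>

definition apply_letter :: "nat \<Rightarrow> ('x stream \<Rightarrow> 'x stream) \<Rightarrow> 'x list \<Rightarrow> 'x list option" where
  "apply_letter N a c = (let c' = rw a (take L c) @ drop L c in
     if L \<le> length c \<and> length c' \<le> N then Some c' else None)"

lemma take_level:
  assumes "c \<in> W" "L \<le> length c"
  shows "take L c \<in> level L" "drop L c \<in> lists \<Sigma>"
proof -
  have "take L c \<noteq> []" using L_pos assms by auto
  then show "take L c \<in> level L" "drop L c \<in> lists \<Sigma>"
    using append_in_W[of "take L c" "drop L c"] assms by (auto simp: level_def)
qed

text \<open>In the entry configuration \<open>x\<close> is copied first, in the other case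
  \<open>c\<close> is on the pushdown stack already. From here on the two cases need not be told
  apart.\<close>

lemma read_run:
  assumes a: "a \<in> A" and x: "x \<in> W" and c: "c \<in> W" "length c \<le> length x + k + 1"
  shows "run M (config_of x k c) [a] (enc (Remove a []), check_stack x k, pushdown x c)"
proof (cases "c = x")
  case True
  have "step M (enc Entry, check_stack x k, [Bottom]) (Some a) (enc (Climb a), check_stack x k, [Bottom])"
    by (rule move_step[OF read_entry[OF a]]) (auto simp: check_at_def check_stack_def top_of_def)
  then show ?thesis
    using climb_run[OF a x] True by (auto simp: config_of_def intro: run.intros)
next
  case False
  have X: "x \<in> lists X" "c \<in> lists X" using x c W_lists by auto
  obtain d where d: "check_at (check_stack x k) (Suc (length c)) = Some d" "d \<in> \<Delta>"
    using check_at_check_stack[OF X(1) c(2)] .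
  obtain g where g: "top_of (pushdown x c) = Some g" "g \<in> \<Gamma>" using top_of_pushdown[OF X(2)] .
  have "step M (enc Moved, check_stack x k, pushdown x c) (Some a)
      (enc (Remove a []), check_stack x k, pushdown x c)"
    by (rule move_step[OF read_moved[OF a d(2) g(2)]]) (simp_all add: d g)
  then show ?thesis using False by (auto simp: config_of_def dest: run_Some)
qed

lemma read_and_remove_run:
  assumes a: "a \<in> A" and x: "x \<in> W" and c: "c \<in> W" "length c \<le> length x + k + 1" "L \<le> length c"
  shows "run M (config_of x k c) [a]
    (enc (Write (rw a (take L c))), check_stack x k, pushdown x (drop L c))"
proof (rule run_eps[OF read_run[OF a x c(1,2)]])
  have "x \<in> lists X" using x W_lists by blast
  from remove_run[OF a this, of "take L c" "drop L c" k "[]"]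
  show "run M (enc (Remove a []), check_stack x k, pushdown x c) []
      (enc (Write (rw a (take L c))), check_stack x k, pushdown x (drop L c))"
    using take_level[OF c(1,3)] c L_pos W_nonempty_string[OF c(1)] by simp
qed

lemma apply_letter_Some:
  assumes a: "a \<in> A" and x: "x \<in> W" and c: "c \<in> W" "length c \<le> length x + k + 1"
    and c': "apply_letter (length x + k + 1) a c = Some c'"
  shows "run M (config_of x k c) [a] (config_of x k c')" "c' \<in> W" "length c' \<le> length x + k + 1"
    "\<And>\<tau>. \<tau> \<in> streams \<Sigma> \<Longrightarrow> a (c @- \<tau>) = c' @- \<tau>"
proof -
  have len: "L \<le> length c" "length c' \<le> length x + k + 1"
    and c'_eq: "c' = rw a (take L c) @ drop L c"
    using c' by (auto simp: apply_letter_def Let_def split: if_splits)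
  note tl = take_level[OF c(1) len(1)]
  show c'W: "c' \<in> W" unfolding c'_eq using append_in_WI rw_W[OF a tl(1)] tl(2) by blast
  show "length c' \<le> length x + k + 1" by (rule len(2))
  have X: "x \<in> lists X" "drop L c \<in> lists X" "rw a (take L c) \<in> lists X"
    using x tl(2) rw_W[OF a tl(1)] W_lists by auto
  have "run M (enc (Write ([] @ rw a (take L c))), check_stack x k, pushdown x (drop L c)) []
      (enc (Write []), check_stack x k, pushdown x (rw a (take L c) @ drop L c))"
    using X rw_length[OF a tl(1)] len c'_eq by (intro write_run) auto
  then have "run M (enc (Write (rw a (take L c))), check_stack x k, pushdown x (drop L c)) []
      (config_of x k c')"
    using run_eps finish_run[OF x c'W len(2)] c'_eq by fastforce
  then show "run M (config_of x k c) [a] (config_of x k c')"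
    using run_eps read_and_remove_run[OF a x c len(1)] by blast
  show "a (c @- \<tau>) = c' @- \<tau>" if "\<tau> \<in> streams \<Sigma>" for \<tau>
  proof -
    have "drop L c @- \<tau> \<in> streams \<Sigma>" using that tl(2) by (auto simp: streams_iff_sset)
    then have "a (take L c @- (drop L c @- \<tau>)) = rw a (take L c) @- (drop L c @- \<tau>)"
      by (rule rw[OF a tl(1)])
    then show ?thesis unfolding c'_eq by (metis append_take_drop_id shift_append)
  qed
qed

lemma apply_letter_None:
  assumes a: "a \<in> A" and x: "x \<in> W" and c: "c \<in> W" "length c \<le> length x + k + 1"
    and None: "apply_letter (length x + k + 1) a c = None"
  shows "\<exists>D. run M (config_of x k c) [a] D \<and> stuck D"
proof (cases "L \<le> length c")
  case False
  have X: "x \<in> lists X" using x W_lists by blast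
  let ?D = "(enc (Remove a c), check_stack x k, [Bottom])"
  have S: "Remove a c \<in> S" using a c False by simp
  have "run M (enc (Remove a []), check_stack x k, pushdown x c) [] ?D"
    using remove_all_run[OF a X c(2), of "[]"] c False by simp
  then have "run M (config_of x k c) [a] ?D" using run_eps read_run[OF a x c] by blast
  moreover have "\<not> move (Remove a c) l d (Some Bottom) act s'" for l d act s'
    by (auto elim: move.cases)
  then have "stuck ?D"
    using S by (auto simp: stuck_def reading_config_def reading_state_M step_M_iff top_of_def)
  ultimately show ?thesis by blast
next
  case True
  note tl = take_level[OF c(1) True]
  let ?r = "rw a (take L c)"
  have X: "x \<in> lists X" "drop L c \<in> lists X" "?r \<in> lists X"
    using x tl(2) rw_W[OF a tl(1)] W_lists by auto
  have K: "length ?r \<le> K" using rw_length[OF a tl(1)] .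
  have len: "length x + k + 1 < length ?r + length (drop L c)"
    using None True by (auto simp: apply_letter_def Let_def split: if_splits)
  \<comment> \<open>The number of letters still unwritten when \<open>Top\<close> is reached. It is
    at most \<open>length ?r\<close>, as \<open>drop L c\<close> fits on the stack.\<close>
  define n where "n = length ?r + length (drop L c) - (length x + k + 1)"
  let ?r1 = "take n ?r" and ?r2 = "drop n ?r"
  have n: "0 < n" "n \<le> length ?r" "length (?r2 @ drop L c) = length x + k + 1"
    using len c(2) unfolding n_def by auto
  have r1: "?r1 \<in> lists X" "?r1 \<noteq> []" using X(3) n by (auto dest: in_set_takeD)
  let ?D = "(enc (Write ?r1), check_stack x k, pushdown x (?r2 @ drop L c))"
  have "run M (enc (Write (?r1 @ ?r2)), check_stack x k, pushdown x (drop L c)) [] ?D"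
    using X K n by (intro write_run) auto
  then have "run M (config_of x k c) [a] ?D"
    using run_eps[OF read_and_remove_run[OF a x c True], of ?D] by simp
  moreover have "stuck ?D"
  proof -
    obtain d where "check_at (check_stack x k) (Suc (length (?r2 @ drop L c))) = Some d" "d = Top"
      using check_at_check_stack[OF X(1), of "length (?r2 @ drop L c)" k] n(3) by auto
    then have top: "check_at (check_stack x k) (length (pushdown x (?r2 @ drop L c))) = Some Top"
      by simp
    have "\<not> move (Write ?r1) l (Some Top) g act s'" for l g act s'
      using r1(2) by (auto elim: move.cases)
    moreover have "Write ?r1 \<in> S" using r1 K by simp
    ultimately show ?thesis
      unfolding stuck_def reading_config_def reading_state_M
      using top step_M_iff by (auto simp del: length_pushdown)
  qed
  ultimately show ?thesis by blast
qed

section \<open>Words acting on strings\<close>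

fun apply_word :: "nat \<Rightarrow> ('x stream \<Rightarrow> 'x stream) list \<Rightarrow> 'x list \<Rightarrow> 'x list option" where
  "apply_word N [] c = Some c"
| "apply_word N (a # w) c = Option.bind (apply_letter N a c) (apply_word N w)"

lemma apply_word_append: "apply_word N (u @ v) c = Option.bind (apply_word N u c) (apply_word N v)"
proof (induction u arbitrary: c)
  case (Cons a u)
  then show ?case by (cases "apply_letter N a c") auto
qed simp

lemma word_value_Cons: "word_value HT (a # w) = compose \<Omega> (word_value HT w) a"
  by (simp add: word_value_def mult_HT)

lemma word_value_carrier: "w \<in> lists A \<Longrightarrow> word_value HT w \<in> carrier HT"
proof (induction w)
  case Nil
  then show ?case using group.is_monoid[OF group_HT] by (simp add: word_value_def monoid.one_closed)
next
  case (Cons a w)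
  then show ?case
    using group.is_monoid[OF group_HT] A_carrier monoid.m_closed by (fastforce simp: word_value_def)
qed

lemma apply_word_Some:
  assumes x: "x \<in> W"
  shows "w \<in> lists A \<Longrightarrow> c \<in> W \<Longrightarrow> length c \<le> length x + k + 1 \<Longrightarrow>
    apply_word (length x + k + 1) w c = Some c' \<Longrightarrow>
    run M (config_of x k c) w (config_of x k c') \<and> c' \<in> W \<and> length c' \<le> length x + k + 1 \<and>
      (\<forall>\<tau> \<in> streams \<Sigma>. word_value HT w (c @- \<tau>) = c' @- \<tau>)"
proof (induction w arbitrary: c)
  case Nil
  then show ?case using shift_in_\<Omega>I by (auto intro: run.intros simp: word_value_def one_HT)
next
  case (Cons a w)
  then obtain d where d: "apply_letter (length x + k + 1) a c = Some d"
    "apply_word (length x + k + 1) w d = Some c'"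
    by (auto simp: bind_eq_Some_conv)
  have a: "a \<in> A" and w: "w \<in> lists A" using Cons.prems by auto
  note l = apply_letter_Some[OF a x Cons.prems(2,3) d(1)]
  note IH = Cons.IH[OF w l(2,3) d(2)]
  have "run M (config_of x k c) (a # w) (config_of x k c')"
    using run_trans[OF l(1)] IH by fastforce
  moreover have "word_value HT (a # w) (c @- \<tau>) = c' @- \<tau>" if "\<tau> \<in> streams \<Sigma>" for \<tau>
    using that IH l(4) shift_in_\<Omega>I[OF Cons.prems(2)] by (simp add: word_value_Cons compose_def)
  ultimately show ?case using IH by blast
qed

lemma apply_word_None:
  assumes x: "x \<in> W"
  shows "w \<in> lists A \<Longrightarrow> c \<in> W \<Longrightarrow> length c \<le> length x + k + 1 \<Longrightarrow>
    apply_word (length x + k + 1) w c = None \<Longrightarrow>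
    \<exists>u v D. w = u @ v \<and> run M (config_of x k c) u D \<and> stuck D"
proof (induction w arbitrary: c)
  case (Cons a w)
  have a: "a \<in> A" and w: "w \<in> lists A" using Cons.prems by auto
  show ?case
  proof (cases "apply_letter (length x + k + 1) a c")
    case None
    then obtain D where "run M (config_of x k c) [a] D" "stuck D"
      using apply_letter_None[OF a x Cons.prems(2,3)] by blast
    moreover have "a # w = [a] @ w" by simp
    ultimately show ?thesis by blast
  next
    case (Some d)
    note l = apply_letter_Some[OF a x Cons.prems(2,3) Some]
    have "apply_word (length x + k + 1) w d = None" using Cons.prems(4) Some by simp
    then obtain u v D where "w = u @ v" "run M (config_of x k d) u D" "stuck D"
      using Cons.IH[OF w l(2,3)] by blast
    then have "a # w = (a # u) @ v \<and> run M (config_of x k c) (a # u) D \<and> stuck D"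
      using run_trans[OF l(1)] by fastforce
    then show ?thesis by blast
  qed
qed simp

text \<open>Each input letter shortens the string by at most \<open>L\<close> and lengthens it by at
  most \<open>K\<close>.\<close>

lemma apply_word_defined:
  "w \<in> lists A \<Longrightarrow> c \<in> W \<Longrightarrow> L * length w \<le> length c \<Longrightarrow> length c + K * length w \<le> N \<Longrightarrow>
    apply_word N w c \<noteq> None"
proof (induction w arbitrary: c)
  case (Cons a w)
  have a: "a \<in> A" and w: "w \<in> lists A" using Cons.prems by auto
  have "L + L * length w \<le> length c" using Cons.prems(3) by simp
  then have L: "L \<le> length c" by linarith
  note tl = take_level[OF Cons.prems(2) L]
  let ?c = "rw a (take L c) @ drop L c"
  have K: "length (rw a (take L c)) \<le> K" using rw_length[OF a tl(1)] .
  have "?c \<in> W" using append_in_WI rw_W[OF a tl(1)] tl(2) by blast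
  moreover have "L * length w \<le> length ?c" using Cons.prems(3) by simp
  moreover have cK: "length ?c + K * length w \<le> N" using Cons.prems(4) K L by simp
  ultimately have "apply_word N w ?c \<noteq> None" using Cons.IH w by blast
  moreover have "length ?c \<le> N" using cK by linarith
  ultimately show ?case using L by (simp add: apply_letter_def Let_def)
qed simp

section \<open>Entry configurations and the accepted language\<close>

lemma initialised_M:
  "initialised M q cs \<Longrightarrow>
    q = enc Init0 \<and> cs = [] \<or> q = enc Init1 \<and> (\<exists>u \<in> lists \<Sigma>. cs = Bottom # map cS (rev u)) \<or>
    q = enc Init2 \<and> (\<exists>x \<in> W. \<exists>k. cs = Bottom # map cS (rev x) @ replicate k Padding) \<or>
    q = enc Ready \<and> (\<exists>x \<in> W. \<exists>k. cs = check_stack x k)"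
proof (induction rule: initialised.induct)
  case (2 q cs d q')
  from 2(2) consider
      "q = enc Init0" "d = Bottom" "q' = enc Init1"
    | "q = enc Init2" "d = Padding" "q' = enc Init2"
    | "q = enc Init2" "d = Top" "q' = enc Ready"
    | \<sigma> where "q = enc Init1" "\<sigma> \<in> \<Sigma>" "d = cS \<sigma>" "q' = enc Init1"
    | q0 where "q = enc Init1" "q0 \<in> Q" "d = cS q0" "q' = enc Init2"
    by (auto simp: M_def)
  then show ?case
  proof cases
    case 1
    then show ?thesis using 2(3) by (auto intro: bexI[of _ "[]"])
  next
    case 2
    then obtain x k where x: "x \<in> W" "cs = Bottom # map cS (rev x) @ replicate k Padding"
      using \<open>_ \<or> _\<close> by auto
    then have "cs @ [d] = Bottom # map cS (rev x) @ replicate (Suc k) Padding"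
      using 2 by (simp add: replicate_append_same)
    then show ?thesis using 2 x by blast
  next
    case 3
    then obtain x k where x: "x \<in> W" "cs = Bottom # map cS (rev x) @ replicate k Padding"
      using 2(3) by auto
    then have "cs @ [d] = check_stack x k" using 3 by (simp add: check_stack_def)
    then show ?thesis using 3 x by blast
  next
    case (4 \<sigma>)
    then obtain u where u: "u \<in> lists \<Sigma>" "cs = Bottom # map cS (rev u)"
      using 2(3) by auto
    then have "cs @ [d] = Bottom # map cS (rev (\<sigma> # u))" "\<sigma> # u \<in> lists \<Sigma>" using 4 by auto
    then show ?thesis using 4 by blast
  next
    case (5 q0)
    then obtain u where u: "u \<in> lists \<Sigma>" "cs = Bottom # map cS (rev u)"
      using 2(3) by auto
    then have "cs @ [d] = Bottom # map cS (rev (q0 # u)) @ replicate 0 Padding" "q0 # u \<in> W"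
      using 5 by (auto simp: Cons_in_W)
    then show ?thesis using 5 by blast
  qed
qed simp

lemma initialised_check_stack:
  assumes "x \<in> W"
  shows "initialised M (enc Ready) (check_stack x k)"
proof -
  obtain q u where x: "x = q # u" "q \<in> Q" "u \<in> lists \<Sigma>" using assms by (auto simp: fin_strings_def)
  have "initialised M (enc Init1) ([] @ [Bottom])"
    by (rule initialised.intros(2)[of M "enc Init0"])
      (use initialised.intros(1)[of M] in \<open>simp_all add: M_def\<close>)
  then have "u \<in> lists \<Sigma> \<Longrightarrow> initialised M (enc Init1) (Bottom # map cS (rev u))" for u
  proof (induction u)
    case (Cons \<sigma> u)
    then have "initialised M (enc Init1) ((Bottom # map cS (rev u)) @ [cS \<sigma>])"
      by (intro initialised.intros(2)[of M "enc Init1"]) (auto simp: M_def)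
    then show ?case by simp
  qed simp
  then have "initialised M (enc Init2) ((Bottom # map cS (rev u)) @ [cS q])"
    using x by (intro initialised.intros(2)[of M "enc Init1"]) (auto simp: M_def)
  then have 0: "initialised M (enc Init2) (Bottom # map cS (rev x))" using x by simp
  have "initialised M (enc Init2) (Bottom # map cS (rev x) @ replicate k Padding)"
  proof (induction k)
    case (Suc k)
    then have "initialised M (enc Init2) ((Bottom # map cS (rev x) @ replicate k Padding) @ [Padding])"
      by (intro initialised.intros(2)[of M "enc Init2"]) (auto simp: M_def)
    then show ?case by (simp add: replicate_append_same)
  qed (use 0 in simp)
  then have "initialised M (enc Ready) ((Bottom # map cS (rev x) @ replicate k Padding) @ [Top])"
    by (intro initialised.intros(2)[of M "enc Init2"]) (auto simp: M_def)
  then show ?thesis by (simp add: check_stack_def)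
qed

text \<open>With an empty pushdown stack no symbol of either stack is visible, and only
  \<open>Ready\<close> has a move for that case. All other ends of the first stage are dead
  ends.\<close>

lemma first_step_iff:
  "initialised M q cs \<and> step M (q, cs, []) l C \<longleftrightarrow>
    (\<exists>x \<in> W. \<exists>k. q = enc Ready \<and> cs = check_stack x k \<and> l = None \<and> C = config_of x k x)"
proof
  assume *: "initialised M q cs \<and> step M (q, cs, []) l C"
  from * obtain s where s: "s \<in> S" "q = enc s" using step_M_state by fastforce
  obtain act s' ps' where m: "move s l None None act s'" "apply_action act [] = Some ps'"
    "C = (enc s', cs, ps')"
    using * s by (auto simp: step_M_iff check_at_def top_of_def)
  from m(1) have e: "s = Ready \<and> l = None \<and> act = Push Bottom \<and> s' = Entry"
    by (auto elim: move.cases)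
  then obtain x k where "x \<in> W" "cs = check_stack x k"
    using initialised_M[of q cs] * s by auto
  then show "\<exists>x \<in> W. \<exists>k. q = enc Ready \<and> cs = check_stack x k \<and> l = None \<and> C = config_of x k x"
    using e m s by (auto simp: config_of_def)
next
  assume "\<exists>x \<in> W. \<exists>k. q = enc Ready \<and> cs = check_stack x k \<and> l = None \<and> C = config_of x k x"
  then obtain x k where x: "x \<in> W" "q = enc Ready" "cs = check_stack x k" "l = None"
    "C = config_of x k x" by blast
  have "step M (enc Ready, check_stack x k, []) None (enc Entry, check_stack x k, [Bottom])"
    by (rule move_step[OF enter]) (auto simp: check_at_def top_of_def)
  then show "initialised M q cs \<and> step M (q, cs, []) l C"
    using x initialised_check_stack by (simp add: config_of_def)
qed

lemma entry_config_M: "entry_config M C \<longleftrightarrow> (\<exists>x \<in> W. \<exists>k. C = config_of x k x)"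
  unfolding entry_config_def first_step_iff by blast

lemma reading_config_of: "reading_config M (config_of x k c)"
  by (simp add: reading_config_def reading_state_M config_of_def)

lemma accepting_config_of: "accepting_config M (config_of x k c) \<longleftrightarrow> c \<noteq> x"
  by (simp add: accepting_config_def config_of_def)

text \<open>An accepting run ends, by determinism, in the configuration of the string that the word
  makes of the guess, and a changed guess refutes triviality by \<open>string_determined\<close>.
  For a nontrivial word, a long prefix of a moved point with enough padding is an accepting
  guess.\<close>

lemma language_M: "language M = coWP HT A"
proof (intro equalityI subsetI)
  fix w assume "w \<in> language M"
  then obtain q cs D where w: "w \<in> lists A" and i: "initialised M q cs"
    and r: "run M (q, cs, []) w D" and acc: "accepting_config M D"
    unfolding language_def by auto
  have D: "reading_config M D"
    using acc by (simp add: accepting_config_def reading_config_def reading_state_M)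
  obtain x k where x: "x \<in> W" and r': "run M (config_of x k x) w D"
  proof -
    from r show ?thesis
    proof cases
      case 1
      \<comment> \<open>A run without steps ends where the first stage ended, and no such state is
        accepting.\<close>
      then show ?thesis using initialised_M[OF i] acc by (auto simp: accepting_config_def)
    next
      case (2 C)
      then have "initialised M q cs \<and> step M (q, cs, []) None C" using i by simp
      then obtain x k where "x \<in> W" "C = config_of x k x" unfolding first_step_iff by blast
      then show ?thesis using that 2(2) by blast
    next
      case (3 a C w')
      then have "initialised M q cs \<and> step M (q, cs, []) (Some a) C" using i by simp
      then show ?thesis unfolding first_step_iff by blast
    qed
  qed
  show "w \<in> coWP HT A"
  proof (cases "apply_word (length x + k + 1) w x")
    case None
    then obtain u v E where "w = u @ v" "run M (config_of x k x) u E" "stuck E"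
      using apply_word_None[OF x w x _ None] by fastforce
    \<comment> \<open>Determinism forces the accepting run through the stuck configuration
      \<open>E\<close>.\<close>
    then have "run M E v D" using run_deterministic[OF deterministic_M] r' D by blast
    then show ?thesis using \<open>stuck E\<close> D unfolding stuck_def by cases auto
  next
    case (Some c)
    have c: "run M (config_of x k x) w (config_of x k c)" "c \<in> W"
      "\<And>\<tau>. \<tau> \<in> streams \<Sigma> \<Longrightarrow> word_value HT w (x @- \<tau>) = c @- \<tau>"
      using apply_word_Some[OF x w x _ Some] by auto
    then have "D = config_of x k c"
      using run_deterministic_end[OF deterministic_M r' c(1) D reading_config_of] by blast
    then have "c \<noteq> x" using acc accepting_config_of by simp
    moreover have "c = x" if "word_value HT w = \<one>\<^bsub>HT\<^esub>"
      using c shift_in_\<Omega>I[OF x] that by (intro string_determined[OF c(2) x]) (simp add: one_HT)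
    ultimately show ?thesis using w by (auto simp: coWP_def)
  qed
next
  fix w assume "w \<in> coWP HT A"
  then have w: "w \<in> lists A" and ne: "word_value HT w \<noteq> \<one>\<^bsub>HT\<^esub>" by (auto simp: coWP_def)
  have "word_value HT w \<in> extensional \<Omega>" using word_value_carrier[OF w] carrier_HT_iff by blast
  moreover have "\<one>\<^bsub>HT\<^esub> \<in> extensional \<Omega>" by (simp add: one_HT)
  ultimately obtain \<omega> where \<omega>: "\<omega> \<in> \<Omega>" "word_value HT w \<omega> \<noteq> \<omega>"
    using ne extensionalityI[of "word_value HT w" \<Omega> "\<one>\<^bsub>HT\<^esub>"] by (auto simp: one_HT)
  \<comment> \<open>Each letter of \<open>w\<close> uses up at most \<open>L\<close> letters of
    \<open>x\<close>; the extra one meets the condition \<open>1 \<le> n\<close> of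
    \<open>\<Omega>_split\<close> for every \<open>w\<close>. The padding chosen next allows growth
    by \<open>K\<close> per letter.\<close>
  obtain x \<tau> where x: "\<omega> = x @- \<tau>" "x \<in> W" "length x = L * length w + 1" "\<tau> \<in> streams \<Sigma>"
    using \<Omega>_split[OF \<omega>(1), of "L * length w + 1"] by auto
  define k where "k = K * length w"
  obtain c where "apply_word (length x + k + 1) w x = Some c"
    using apply_word_defined[OF w x(2), of "length x + k + 1"] x(3) k_def by auto
  then have c: "run M (config_of x k x) w (config_of x k c)" "word_value HT w (x @- \<tau>) = c @- \<tau>"
    using apply_word_Some[OF x(2) w x(2)] x(4) by auto
  then have acc: "accepting_config M (config_of x k c)" using accepting_config_of \<omega> x(1) by auto
  have "initialised M (enc Ready) (check_stack x k) \<and>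
      step M (enc Ready, check_stack x k, []) None (config_of x k x)"
    using first_step_iff x(2) by blast
  moreover from this have "run M (enc Ready, check_stack x k, []) w (config_of x k c)"
    using c(1) run.intros(2) by blast
  ultimately show "w \<in> language M"
    using w acc unfolding language_def by (simp only: M_simps mem_Collect_eq) blast
qed

lemma P6_M: "P6 M"
  unfolding P6_def
proof (intro allI impI, elim conjE)
  fix C u v assume C: "entry_config M C" and u: "u \<in> lists (input M)" and v: "v \<in> lists (input M)"
    and nv: "v \<notin> language M"
  obtain x k where x: "x \<in> W" "C = config_of x k x" using C entry_config_M by blast
  have uv: "u @ v \<in> lists A" "u \<in> lists A" "v \<in> lists A" using u v by auto
  have v1: "word_value HT v = \<one>\<^bsub>HT\<^esub>" using nv uv language_M by (auto simp: coWP_def)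
  show "(\<exists>D. reaches M C u D \<and> reaches M C (u @ v) D) \<or> fails M C (u @ v)"
  proof (cases "apply_word (length x + k + 1) (u @ v) x")
    case None
    then obtain u' v' D where "u @ v = u' @ v'" "run M C u' D" "stuck D"
      using apply_word_None[OF x(1) uv(1) x(1) _ None] x(2) by fastforce
    then have "gets_stuck M C (u @ v)" unfolding gets_stuck_def stuck_def by blast
    then show ?thesis unfolding fails_def by blast
  next
    case (Some e)
    then obtain c where c: "apply_word (length x + k + 1) u x = Some c"
      "apply_word (length x + k + 1) v c = Some e"
      by (auto simp: apply_word_append bind_eq_Some_conv)
    have 1: "run M C u (config_of x k c)" "c \<in> W" "length c \<le> length x + k + 1"
      using apply_word_Some[OF x(1) uv(2) x(1) _ c(1)] x(2) by auto
    have 2: "e \<in> W" "\<And>\<tau>. \<tau> \<in> streams \<Sigma> \<Longrightarrow> c @- \<tau> = e @- \<tau>"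
      using apply_word_Some[OF x(1) uv(3) 1(2,3) c(2)] shift_in_\<Omega>I[OF 1(2)]
      by (auto simp: v1 one_HT)
    \<comment> \<open>The trivial word \<open>v\<close> fixes every continuation of
      \<open>c\<close>, and all tails together determine the string.\<close>
    have "c = e" using string_determined[OF 1(2) 2] .
    moreover have "run M C (u @ v) (config_of x k e)"
      using apply_word_Some[OF x(1) uv(1) x(1) _ Some] x(2) by auto
    ultimately show ?thesis using 1(1) reading_config_of unfolding reaches_def by blast
  qed
qed

section \<open>Termination of silent computations\<close>

fun phase :: "('x stream \<Rightarrow> 'x stream, 'x) machine_state \<Rightarrow> nat" where
  "phase Ready = 5"
| "phase (Climb a) = 4"
| "phase (Look a) = 4"
| "phase (Copy a x) = 4"
| "phase (Remove a p) = 3"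
| "phase (Write r) = 2"
| "phase Unwind = 1"
| "phase _ = 0"

text \<open>Here \<open>n\<close> and \<open>h\<close> are the heights of the check stack and of the pushdown stack. A round
  \<open>Climb\<close>, \<open>Look\<close>, \<open>Copy\<close> raises \<open>h\<close> by one, which leaves three values for its three moves.\<close>

fun progress :: "('x stream \<Rightarrow> 'x stream, 'x) machine_state \<Rightarrow> nat \<Rightarrow> nat \<Rightarrow> nat" where
  "progress (Climb a) n h = 3 * (n + 1 - h)"
| "progress (Look a) n h = 3 * (n + 1 - h) + 2"
| "progress (Copy a x) n h = 3 * (n + 1 - h) - 2"
| "progress (Remove a p) n h = h"
| "progress (Write r) n h = length r"
| "progress Unwind n h = h"
| "progress _ n h = 0"

text \<open>The phases are numbered downward in the order in which a round runs through them, so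
  \<open>progress\<close> has to decrease only within a phase.\<close>

lemma move_progress:
  assumes "move s None (check_at cs (length ps)) (top_of ps) act s'" "apply_action act ps = Some ps'"
  shows "((phase s', progress s' (length cs) (length ps')), (phase s, progress s (length cs) (length ps)))
    \<in> less_than <*lex*> less_than"
proof -
  \<comment> \<open>A visible check symbol confines the height to the check stack, which keeps the
    truncated subtractions in \<open>progress\<close> exact.\<close>
  have *: "1 \<le> h \<and> h \<le> length cs" if "check_at cs h = Some d" for h d
    using that by (auto simp: check_at_def split: if_splits)
  have len: "length ps' = (case act of Push g \<Rightarrow> Suc (length ps) | Pop \<Rightarrow> length ps - 1 | Stay \<Rightarrow> length ps)"
    and pop: "act = Pop \<longrightarrow> 0 < length ps"
    using assms(2) by (cases act; cases ps; auto)+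
  show ?thesis
    using assms(1) unfolding len by cases (use pop in \<open>auto dest!: *\<close>)
qed

lemma P4_M: "P4 M"
  unfolding P4_def
proof clarify
  fix q cs w and f :: "nat \<Rightarrow> (nat, ('x stream \<Rightarrow> 'x stream) stack_symbol) config"
  assume f: "\<forall>i. step M (f i) None (f (Suc i))"
  then have "\<forall>i. \<exists>s \<in> S. fst (f i) = enc s" using step_M_state by blast
  then obtain s where s: "\<And>i. s i \<in> S" "\<And>i. fst (f i) = enc (s i)" by metis
  define r where "r i = (phase (s i), progress (s i) (length (fst (snd (f i)))) (length (snd (snd (f i)))))" for i
  have "(r (Suc i), r i) \<in> less_than <*lex*> less_than" for i
  proof -
    obtain cs ps where fi: "f i = (enc (s i), cs, ps)" using s(2)[of i] by (cases "f i") auto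
    then obtain act s' ps' where m: "move (s i) None (check_at cs (length ps)) (top_of ps) act s'"
      "apply_action act ps = Some ps'" "f (Suc i) = (enc s', cs, ps')"
      using f step_M_iff[OF s(1)] by metis
    have "s (Suc i) = s'" using m s[of "Suc i"] move_closed by (metis enc_eq fst_conv)
    then show ?thesis using move_progress[OF m(1,2)] fi m(3) by (simp add: r_def)
  qed
  moreover have "wf (less_than <*lex*> less_than)" by (simp add: wf_lex_prod)
  ultimately show False by (meson wf_no_infinite_down_chainE)
qed

section \<open>The remaining conditions for a special cspda\<close>

lemma is_cspda_M: "is_cspda M"
proof -
  have "finite \<Delta>" "finite \<Gamma>" using finite_A finite_Q finite_Sigma by (auto simp: \<Delta>_def \<Gamma>_def)
  moreover have "init_trans M \<subseteq> enc ` S \<times> \<Delta> \<times> enc ` S" by (auto simp: M_def)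
  ultimately show ?thesis
    unfolding is_cspda_def using finite_S finite_A move_closed by (auto, blast+)
qed

lemma P1_M: "P1 M"
  unfolding P1_def
proof
  fix q assume q: "q \<in> states M"
  show "reading_state M q \<or> nonreading_state M q"
  proof (cases "q = enc Entry \<or> q = enc Moved")
    case False
    have "l = None" if "move s l d g act s'" "q = enc s" for s l d g act s'
      using that(1) by cases (use False that(2) in auto)
    then show ?thesis using q by (auto simp: nonreading_state_def)
  qed (simp add: reading_state_M)
qed

lemma P3_M: "P3 M"
proof -
  have "(\<exists>ds. cs = Bottom # ds @ [Top] \<and> Bottom \<notin> set ds \<and> Top \<notin> set ds) \<and>
      l = None \<and> snd (snd C) = [Bottom] \<and> reading_config M C"
    if C: "initialised M q cs \<and> step M (q, cs, []) l C" for q cs l C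
  proof -
    obtain x k where x: "cs = check_stack x k" "l = None" "C = config_of x k x"
      using C unfolding first_step_iff by blast
    have "\<exists>ds. cs = Bottom # ds @ [Top] \<and> Bottom \<notin> set ds \<and> Top \<notin> set ds"
      unfolding x(1) check_stack_def
      by (rule exI[of _ "map cS (rev x) @ replicate k Padding"]) auto
    moreover have "reading_config M C" unfolding x(3) by (rule reading_config_of)
    ultimately show ?thesis using x by (simp add: config_of_def)
  qed
  moreover have "g = None" if "move s l d g (Push Bottom) s'" for s l d g s'
    using that by (auto elim: move.cases)
  moreover have "\<not> move s l d g (Push Top) s'" for s l d g s'
    by (auto elim: move.cases)
  moreover have "\<not> move s l d (Some Bottom) Pop s'" for s l d s'
    by (auto elim: move.cases)
  moreover have "\<not> move s l (Some Top) g (Push y) s'" for s l g y s'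
    by (auto elim: move.cases)
  ultimately show ?thesis unfolding P3_def trans_M_iff by (intro conjI) (simp; blast)+
qed

lemma P7_M: "P7 M"
proof -
  have "\<not> entry_state M (enc Moved)"
    unfolding entry_state_def entry_config_M by (auto simp: config_of_def)
  moreover have "entry_state M (enc Entry)"
  proof -
    obtain q where "q \<in> Q" using Q_nonempty by blast
    then have "[q] \<in> W" by (simp add: Cons_in_W)
    then show ?thesis
      unfolding entry_state_def entry_config_M by (auto simp: config_of_def)
  qed
  ultimately show ?thesis unfolding P7_def by (auto simp: reading_state_M)
qed

lemma special_M: "special_cspda M"
  unfolding special_cspda_def P2_def P5_def
  using is_cspda_M P1_M deterministic_M P3_M P4_M P6_M P7_M reading_state_M by simp

end

theorem theorem5p1:
  fixes Q \<Sigma> :: "'x set" and r n :: nat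
  assumes "r \<ge> 1" and "n \<ge> 2"
    and "finite Q" and "card Q = r"
    and "finite \<Sigma>" and "card \<Sigma> = n"
    and "Q \<inter> \<Sigma> = {}"
  shows "special_coET0L_group (higman_thompson Q \<Sigma>)"
proof -
  interpret ht Q \<Sigma> using assms by unfold_locales auto
  obtain A where finA: "finite A" and A: "A \<subseteq> carrier HT" and inv: "\<forall>a \<in> A. inv\<^bsub>HT\<^esub> a \<in> A"
    and gen: "generate HT A = carrier HT"
    by (rule finitely_generated_HT)
  have "\<forall>a \<in> A. \<exists>L. rewrites_level L a" using A carrier_HT_iff by blast
  then obtain lev where lev: "\<And>a. a \<in> A \<Longrightarrow> rewrites_level (lev a) a" by metis
  \<comment> \<open>A length that serves all generators at once; the successor provides
    \<open>1 \<le> L\<close>.\<close>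
  define L where "L = Suc (\<Sum>a \<in> A. lev a)"
  have "rewrites_level L a" if "a \<in> A" for a
  proof (rule rewrites_level_mono[OF lev[OF that]])
    show "lev a \<le> L" using member_le_sum[OF that, of lev] finA by (simp add: L_def)
  qed
  then have "\<forall>a \<in> A. \<forall>p \<in> level L. \<exists>c. c \<in> W \<and> (\<forall>\<tau> \<in> streams \<Sigma>. a (p @- \<tau>) = c @- \<tau>)"
    unfolding rewrites_level_def by blast
  then obtain rw where rw: "\<And>a p. a \<in> A \<Longrightarrow> p \<in> level L \<Longrightarrow> rw a p \<in> W"
    "\<And>a p \<tau>. a \<in> A \<Longrightarrow> p \<in> level L \<Longrightarrow> \<tau> \<in> streams \<Sigma> \<Longrightarrow> a (p @- \<tau>) = rw a p @- \<tau>"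
    by metis
  \<comment> \<open>The table is finite, so the sum of the lengths of its entries bounds each of
    them.\<close>
  define K where "K = (\<Sum>(a, p) \<in> A \<times> level L. length (rw a p))"
  have "length (rw a p) \<le> K" if "a \<in> A" "p \<in> level L" for a p
    using member_le_sum[of "(a, p)" "A \<times> level L" "\<lambda>(a, p). length (rw a p)"] that finA finite_level
    by (simp add: K_def)
  then interpret ht_machine Q \<Sigma> A L K rw
    using finA A rw by unfold_locales (auto simp: L_def)
  have "Letter ` A \<subseteq> check_alphabet M" "Letter ` A \<subseteq> pushdown_alphabet M"
    by (auto simp: \<Delta>_def \<Gamma>_def)
  then show ?thesis
    unfolding special_coET0L_group_def
    using group_HT finA A inv gen special_M language_M M_simps(2) by blast
qed

end
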